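(* Let $c\in\mathbb{C}$, $c\neq0$. Suppose that $P(z)$ is a polynomial and $f(z)$ is a nonconstant meromorphic function. Suppose that $n\geq2$, $m\geq2$ are two integers with $m+n\geq5$ and $(n,m)\neq(3,3)$. Then $f(z)$ is a solution of $$f^n(z)+f^m(z+c)=e^{P(z)}$$ if and only if $n=m$, $f(z)=Ae^{P(z)/n}$ and $P(z)=\alpha z+\beta$ with two constants $\alpha\,(\neq0)$, $\beta$, where $A$ is a constant.
   Context: Meromorphic functions are on the whole complex plane $\mathbb{C}$; $f^n(z)$ means $(f(z))^n$.
   Formalization: The "if" direction fails for an arbitrary constant A (e.g. n=m=4, c=1, P=πiz, f=e^{πiz/4} gives sum 0); the formal statement adds the relation A^n(1+e^{αc})=1 on A, which is also proved in the "only if" direction. *)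

theory Defs
  imports "HOL-Complex_Analysis.Complex_Analysis" "HOL-Computational_Algebra.Polynomial"
begin

text \<open>
  A meromorphic function on the plane is a total function \<^term>\<open>f\<close> that is
  \<^const>\<open>nicely_meromorphic_on\<close> on \<^term>\<open>UNIV\<close>: it is continuous (hence holomorphic) away from
  its poles and takes the dummy value 0 at its poles. An identity between meromorphic functions
  is therefore only required where all functions in it are finite; requiring it at every
  point would impose a spurious condition on the dummy values.
\<close>

definition solves_fermat_shift_eq ::
    "nat \<Rightarrow> nat \<Rightarrow> complex \<Rightarrow> complex poly \<Rightarrow> (complex \<Rightarrow> complex) \<Rightarrow> bool" where
  "solves_fermat_shift_eq n m c P f \<longleftrightarrow>
     (\<forall>z. \<not> is_pole f z \<and> \<not> is_pole f (z + c) \<longrightarrow>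
          f z ^ n + f (z + c) ^ m = exp (poly P z))"

end

theory Submission
  imports Defs
begin

text \<open>
  Put \<open>F = f exp (- P / n)\<close> and \<open>G(z) = f(z + c) exp (- P(z) / m)\<close>. The equation becomes
  \<open>F\<^sup>n + G\<^sup>m = 1\<close>, a curve parametrized by meromorphic functions, and everything rests on showing that \<open>F\<close> is
  constant. Then \<open>f = A exp (P / n)\<close>, and inserting this into the equation forces \<open>n = m\<close> and a linear
  \<open>P\<close> by comparing polynomials (\<open>exponential_solution_linear_exponent\<close>).

  For \<open>n = m\<close> the assumptions give \<open>n \<ge> 4\<close>, and the Fermat curve of degree \<open>n\<close> has genus at least 2, so even
  meromorphic parametrizations are constant (\<open>fermat_curve_proportional\<close>). For \<open>n \<noteq> m\<close> the completed
  curve may be elliptic, and elliptic functions do parametrize it. Here the shift helps: a pole of order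
  \<open>p\<close> at \<open>z\<close> forces a pole of order \<open>p n / m\<close> at \<open>z + c\<close>, and running along the translates of
  \<open>z\<close> in the direction of decreasing orders contradicts integrality (\<open>no_poles_if_exponents_differ\<close>). So \<open>F\<close>
  and \<open>G\<close> are entire, and the affine curve, without its points at infinity, is hyperbolic
  (\<open>entire_power_sum_one_constant\<close>).

  Both hyperbolicity statements follow from one principle, the Ahlfors-Schwarz lemma
  (\<open>ahlfors_schwarz_plane\<close>): the plane carries no nonzero conformal pseudo-metric whose curvature is
  bounded above by a negative constant. On each curve such a metric is written down explicitly, as the
  squared modulus of the residue differential times a positive function of the coordinates; its pull-back to
  the plane must vanish, so the derivative of the parametrization vanishes.
\<close>

section \<open>Gradient and Laplacian at a point\<close>

text \<open>
  The function has first derivative \<open>a\<close> and second derivative \<open>b\<close> at 0. Working along the two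
  coordinate lines with ordinary one-variable derivatives suffices for the maximum principle and
  avoids second-order Frechet derivatives.
\<close>

definition second_order_at :: "(real \<Rightarrow> real) \<Rightarrow> real \<Rightarrow> real \<Rightarrow> bool" where
  "second_order_at g a b \<longleftrightarrow>
     (\<exists>g'. (\<forall>\<^sub>F t in nhds 0. (g has_real_derivative g' t) (at t)) \<and> g' 0 = a \<and>
           (g' has_real_derivative b) (at 0))"

lemma second_order_at_local_max:
  assumes "second_order_at g a b" and max: "\<forall>\<^sub>F t in nhds 0. g t \<le> g 0"
  shows "b \<le> 0"
proof (rule ccontr)
  assume "\<not> b \<le> 0"
  obtain g' where g': "\<forall>\<^sub>F t in nhds 0. (g has_real_derivative g' t) (at t)" "g' 0 = a"
      "(g' has_real_derivative b) (at 0)"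
    using assms(1) unfolding second_order_at_def by blast
  obtain d where d: "d > 0" "\<And>t. \<bar>t\<bar> < d \<Longrightarrow> (g has_real_derivative g' t) (at t)"
      "\<And>t. \<bar>t\<bar> < d \<Longrightarrow> g t \<le> g 0"
    using eventually_conj[OF g'(1) max] unfolding eventually_nhds_metric by (auto simp: dist_real_def)
  have "g' 0 = 0"
    by (rule DERIV_local_max[OF d(2) d(1)]) (use d in auto)
  obtain e where e: "e > 0" "\<And>h. 0 < h \<Longrightarrow> h < e \<Longrightarrow> g' 0 < g' (0 + h)"
    using DERIV_pos_inc_right[OF g'(3)] \<open>\<not> b \<le> 0\<close> by auto
  define r where "r = min d e / 2"
  have r: "0 < r" "r < d" "r < e"
    using d(1) e(1) by (auto simp: r_def)
  have "\<exists>x. 0 < x \<and> x < r \<and> g r - g 0 = (r - 0) * g' x"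
    using r by (intro MVT2) (auto intro!: d(2))
  then obtain x where "0 < x" "x < r" "g r - g 0 = (r - 0) * g' x"
    by blast
  moreover have "g' x > 0"
    using e(2)[of x] r \<open>g' 0 = 0\<close> \<open>0 < x\<close> \<open>x < r\<close> by auto
  ultimately have "g r > g 0"
    using r by (metis diff_gt_0_iff_gt diff_zero mult_pos_pos)
  with d(3)[of r] r show False
    by auto
qed

lemma second_order_at_add:
  assumes "second_order_at f a b" "second_order_at g c d"
  shows "second_order_at (\<lambda>t. f t + g t) (a + c) (b + d)"
proof -
  obtain f' g' where "\<forall>\<^sub>F t in nhds 0. (f has_real_derivative f' t) (at t)" "f' 0 = a"
      "(f' has_real_derivative b) (at 0)"
      "\<forall>\<^sub>F t in nhds 0. (g has_real_derivative g' t) (at t)" "g' 0 = c"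
      "(g' has_real_derivative d) (at 0)"
    using assms unfolding second_order_at_def by blast
  thus ?thesis
    unfolding second_order_at_def
    by (intro exI[of _ "\<lambda>t. f' t + g' t"] conjI DERIV_add)
       (auto elim: eventually_elim2 intro: DERIV_add)
qed

lemma second_order_at_compose:
  assumes g: "second_order_at g a b"
    and h: "\<forall>\<^sub>F x in nhds (g 0). (h has_real_derivative h' x) (at x)"
    and h': "(h' has_real_derivative h2) (at (g 0))"
  shows "second_order_at (\<lambda>t. h (g t)) (h' (g 0) * a) (h' (g 0) * b + h2 * a\<^sup>2)"
proof -
  obtain g' where g': "\<forall>\<^sub>F t in nhds 0. (g has_real_derivative g' t) (at t)" "g' 0 = a"
      "(g' has_real_derivative b) (at 0)"
    using g unfolding second_order_at_def by blast
  have g0: "(g has_real_derivative a) (at 0)"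
    using eventually_nhds_x_imp_x[OF g'(1)] g'(2) by simp
  have "filterlim g (nhds (g 0)) (nhds 0)"
    using DERIV_isCont[OF g0] by (simp add: isCont_def tendsto_nhds_iff)
  from eventually_compose_filterlim[OF h this]
  have "\<forall>\<^sub>F t in nhds 0. (h has_real_derivative h' (g t)) (at (g t))" .
  with g'(1) have "\<forall>\<^sub>F t in nhds 0. ((\<lambda>t. h (g t)) has_real_derivative h' (g t) * g' t) (at t)"
    by eventually_elim (rule DERIV_chain2)
  moreover have "((\<lambda>t. h' (g t) * g' t) has_real_derivative h' (g 0) * b + h2 * a\<^sup>2) (at 0)"
    by (rule derivative_eq_intros DERIV_chain2[OF h' g0] g'(3) refl)+
       (simp add: g' power2_eq_square)
  ultimately show ?thesis
    unfolding second_order_at_def using g'(2) by (intro exI[of _ "\<lambda>t. h' (g t) * g' t"]) auto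
qed

text \<open>
  The gradient is packed into the complex number \<open>g = u\<^sub>x + \<i> u\<^sub>y\<close>, so that the chain rule becomes
  \<open>\<Delta>(h \<circ> u) = h'(u) \<Delta>u + h''(u) |g|\<^sup>2\<close>; \<open>L\<close> is the Laplacian. The logarithm of every metric below
  is built from squared moduli of entire functions, so this rule computes all curvatures.
\<close>

definition grad_laplacian :: "(complex \<Rightarrow> real) \<Rightarrow> complex \<Rightarrow> complex \<Rightarrow> real \<Rightarrow> bool" where
  "grad_laplacian u z g L \<longleftrightarrow>
     (\<exists>b1 b2. second_order_at (\<lambda>t. u (z + of_real t)) (Re g) b1 \<and>
              second_order_at (\<lambda>t. u (z + \<i> * of_real t)) (Im g) b2 \<and> L = b1 + b2)"

lemma grad_laplacian_local_max:
  assumes "grad_laplacian u z g L" and "\<forall>\<^sub>F w in nhds z. u w \<le> u z"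
  shows "L \<le> 0"
proof -
  have ev: "\<forall>\<^sub>F t in nhds 0. u (z + c * of_real t) \<le> u (z + c * of_real 0)" for c :: complex
  proof -
    have "((\<lambda>t. z + c * of_real t) \<longlongrightarrow> z + c * of_real 0) (nhds 0)"
      by (intro tendsto_intros) (auto simp: filterlim_ident)
    hence "filterlim (\<lambda>t. z + c * of_real t) (nhds z) (nhds 0)"
      by simp
    from eventually_compose_filterlim[OF assms(2) this] show ?thesis
      by simp
  qed
  show ?thesis
    using assms(1) second_order_at_local_max[of "\<lambda>t. u (z + of_real t)"] ev[of 1]
      second_order_at_local_max[of "\<lambda>t. u (z + \<i> * of_real t)"] ev[of \<i>]
    unfolding grad_laplacian_def by (force simp: add_nonpos_nonpos)
qed

lemma grad_laplacian_add: "grad_laplacian u z g L \<Longrightarrow> grad_laplacian v z h M \<Longrightarrow> grad_laplacian (\<lambda>w. u w + v w) z (g + h) (L + M)"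
  unfolding grad_laplacian_def by (force dest: second_order_at_add)

lemma grad_laplacian_compose:
  assumes "grad_laplacian u z g L"
    and "\<forall>\<^sub>F x in nhds (u z). (h has_real_derivative h' x) (at x)"
    and "(h' has_real_derivative h2) (at (u z))"
  shows "grad_laplacian (\<lambda>w. h (u w)) z (of_real (h' (u z)) * g) (h' (u z) * L + h2 * (norm g)\<^sup>2)"
proof -
  obtain b1 b2 where b: "second_order_at (\<lambda>t. u (z + of_real t)) (Re g) b1"
      "second_order_at (\<lambda>t. u (z + \<i> * of_real t)) (Im g) b2" "L = b1 + b2"
    using assms(1) unfolding grad_laplacian_def by blast
  have "second_order_at (\<lambda>t. h (u (z + of_real t))) (h' (u z) * Re g) (h' (u z) * b1 + h2 * (Re g)\<^sup>2)"
    using second_order_at_compose[OF b(1), of h h' h2] assms(2,3) by simp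
  moreover have "second_order_at (\<lambda>t. h (u (z + \<i> * of_real t))) (h' (u z) * Im g) (h' (u z) * b2 + h2 * (Im g)\<^sup>2)"
    using second_order_at_compose[OF b(2), of h h' h2] assms(2,3) by simp
  ultimately show ?thesis
    unfolding grad_laplacian_def cmod_power2 using b(3)
    by (intro exI[of _ "h' (u z) * b1 + h2 * (Re g)\<^sup>2"] exI[of _ "h' (u z) * b2 + h2 * (Im g)\<^sup>2"])
       (auto simp: algebra_simps)
qed

text \<open>
  The terms with the second derivative of \<open>F\<close> carry the factors \<open>1\<^sup>2\<close> and \<open>\<i>\<^sup>2\<close> along the two
  coordinate directions and cancel, which is why only the first derivative survives.
\<close>

lemma grad_laplacian_norm_square:
  assumes F: "F holomorphic_on UNIV"
  shows "grad_laplacian (\<lambda>w. (norm (F w))\<^sup>2) z (2 * F z * cnj (deriv F z)) (4 * (norm (deriv F z))\<^sup>2)"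
proof -
  let ?F' = "deriv F" and ?F2 = "deriv (deriv F)"
  have F1: "(F has_field_derivative ?F' w) (at w)" for w
    using F by (simp add: holomorphic_derivI)
  have F2: "(?F' has_field_derivative ?F2 w) (at w)" for w
    using holomorphic_deriv[OF F] by (simp add: holomorphic_derivI)
  have so: "second_order_at (\<lambda>t. (norm (F (z + c * of_real t)))\<^sup>2) (2 * Re (cnj (F z) * (c * ?F' z)))
         (2 * (norm (c * ?F' z))\<^sup>2 + 2 * Re (cnj (F z) * (c\<^sup>2 * ?F2 z)))" for c
  proof -
    have lin: "((\<lambda>t. z + c * of_real t) has_vector_derivative c) (at t)" for t
      by (auto intro!: derivative_eq_intros)
    have v1: "((\<lambda>t. F (z + c * of_real t)) has_vector_derivative c * ?F' (z + c * of_real t)) (at t)" for t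
      using field_vector_diff_chain_at[OF lin F1] by (simp add: o_def)
    have v2: "((\<lambda>t. ?F' (z + c * of_real t)) has_vector_derivative c * ?F2 (z + c * of_real t)) (at t)" for t
      using field_vector_diff_chain_at[OF lin F2] by (simp add: o_def)
    have re: "((\<lambda>t. Re (cnj (a t) * b t)) has_real_derivative Re (cnj a' * b s + cnj (a s) * b')) (at s)"
      if "(a has_vector_derivative a') (at s)" "(b has_vector_derivative b') (at s)" for a b a' b' s
    proof -
      have "((\<lambda>t. cnj (a t) * b t) has_vector_derivative (cnj (a s) * b' + cnj a' * b s)) (at s)"
        using that by (intro has_vector_derivative_mult has_vector_derivative_cnj)
      thus ?thesis
        using bounded_linear.has_vector_derivative[OF bounded_linear_Re]
        unfolding has_real_derivative_iff_has_vector_derivative by (fastforce simp: algebra_simps)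
    qed
    have d1: "((\<lambda>t. (norm (F (z + c * of_real t)))\<^sup>2) has_real_derivative
        2 * Re (cnj (F (z + c * of_real t)) * (c * ?F' (z + c * of_real t)))) (at t)" for t
    proof -
      have "((\<lambda>t. Re (cnj (F (z + c * of_real t)) * F (z + c * of_real t))) has_real_derivative
        2 * Re (cnj (F (z + c * of_real t)) * (c * ?F' (z + c * of_real t)))) (at t)"
        by (rule DERIV_cong[OF re[OF v1 v1]]) (simp add: algebra_simps)
      thus ?thesis
        unfolding cmod_power2 by (simp add: power2_eq_square)
    qed
    have d2: "((\<lambda>t. 2 * Re (cnj (F (z + c * of_real t)) * (c * ?F' (z + c * of_real t)))) has_real_derivative
        (2 * (norm (c * ?F' z))\<^sup>2 + 2 * Re (cnj (F z) * (c\<^sup>2 * ?F2 z)))) (at 0)"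
    proof -
      have "((\<lambda>t. c * ?F' (z + c * of_real t)) has_vector_derivative c * (c * ?F2 (z + c * of_real 0))) (at 0)"
        by (intro has_vector_derivative_mult_right v2)
      from DERIV_cmult[OF re[OF v1[of 0] this], of 2] show ?thesis
        by (rule DERIV_cong) (unfold cmod_power2, simp add: power2_eq_square algebra_simps)
    qed
    show ?thesis
      unfolding second_order_at_def using d1 d2 by (intro exI conjI) auto
  qed
  have "second_order_at (\<lambda>t. (norm (F (z + of_real t)))\<^sup>2) (Re (2 * F z * cnj (?F' z)))
          (2 * (norm (?F' z))\<^sup>2 + 2 * Re (cnj (F z) * ?F2 z))"
    using so[of 1] by (simp add: algebra_simps)
  moreover have "second_order_at (\<lambda>t. (norm (F (z + \<i> * of_real t)))\<^sup>2) (Im (2 * F z * cnj (?F' z)))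
          (2 * (norm (?F' z))\<^sup>2 - 2 * Re (cnj (F z) * ?F2 z))"
    using so[of \<i>] by (simp add: norm_mult algebra_simps)
  ultimately show ?thesis
    unfolding grad_laplacian_def by (intro exI conjI) (assumption, assumption, simp)
qed

lemma grad_laplacian_ln:
  assumes "grad_laplacian u z g L" and "u z > 0"
  shows "grad_laplacian (\<lambda>w. ln (u w)) z (of_real (1 / u z) * g) (L / u z - (norm g)\<^sup>2 / (u z)\<^sup>2)"
proof -
  have "\<forall>\<^sub>F x in nhds (u z). x > 0"
    using assms(2) by (simp add: eventually_nhds_in_open[of "{0<..}", simplified])
  hence "\<forall>\<^sub>F x in nhds (u z). (ln has_real_derivative 1 / x) (at x)"
    by eventually_elim (auto intro!: derivative_eq_intros)
  moreover have "((\<lambda>x. 1 / x) has_real_derivative - (1 / (u z)\<^sup>2)) (at (u z))"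
    using assms(2) by (auto intro!: derivative_eq_intros simp: power2_eq_square)
  ultimately show ?thesis
    using grad_laplacian_compose[OF assms(1), of ln "\<lambda>x. 1 / x" "- (1 / (u z)\<^sup>2)"] by simp
qed

lemma grad_laplacian_scale:
  assumes "grad_laplacian u z g L"
  shows "grad_laplacian (\<lambda>w. k * u w) z (of_real k * g) (k * L)"
  using grad_laplacian_compose[OF assms, of "\<lambda>x. k * x" "\<lambda>_. k" 0] by (auto intro!: derivative_eq_intros)

lemma grad_laplacian_const: "grad_laplacian (\<lambda>_. k) z 0 0"
  unfolding grad_laplacian_def second_order_at_def
  by (intro exI[of _ 0] conjI exI[of _ "\<lambda>_. 0"]) (auto intro!: derivative_eq_intros)

section \<open>The Ahlfors-Schwarz lemma on the plane\<close>

text \<open>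
  Here \<open>\<rho>\<close> is the square of the density of a conformal pseudo-metric with curvature bounded above by
  a negative constant wherever it does not vanish. Compare it on the disc of radius \<open>R\<close> with the
  Poincare metric, whose squared density is a multiple of \<open>R\<^sup>2 / (R\<^sup>2 - |z|\<^sup>2)\<^sup>2\<close>: the quotient
  attains its maximum inside the disc, and there the Laplacian of its logarithm is at most 0, so the
  curvature bound makes the quotient at most a constant. The Poincare density at a fixed point tends to 0 as
  \<open>R\<close> grows.
\<close>

lemma ahlfors_schwarz_plane:
  fixes \<rho> :: "complex \<Rightarrow> real"
  assumes cont: "continuous_on UNIV \<rho>" and nonneg: "\<And>z. \<rho> z \<ge> 0" and K: "K > 0"
    and curv: "\<And>z. \<rho> z > 0 \<Longrightarrow>
          \<exists>u g L. (\<forall>\<^sub>F w in nhds z. \<rho> w = exp (u w)) \<and> grad_laplacian u z g L \<and> K * \<rho> z \<le> L"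
  shows "\<rho> z = 0"
proof (rule ccontr)
  assume "\<rho> z \<noteq> 0"
  hence pos: "\<rho> z > 0"
    using nonneg[of z] by simp
  have bound: "\<rho> z * (R\<^sup>2 - (norm z)\<^sup>2)\<^sup>2 \<le> 8 * R\<^sup>2 / K" if R: "R > norm z" for R
  proof -
    define \<Phi> where "\<Phi> = (\<lambda>w. \<rho> w * (R\<^sup>2 - (norm w)\<^sup>2)\<^sup>2)"
    have "continuous_on (cball 0 R) \<Phi>"
      unfolding \<Phi>_def by (intro continuous_intros continuous_on_subset[OF cont]) auto
    moreover have "cball (0::complex) R \<noteq> {}"
      using order.trans[OF norm_ge_zero less_imp_le[OF R]] by simp
    ultimately obtain a where a: "a \<in> cball 0 R" "\<And>w. w \<in> cball 0 R \<Longrightarrow> \<Phi> w \<le> \<Phi> a"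
      using continuous_attains_sup[of "cball (0::complex) R" \<Phi>] by auto
    have "R\<^sup>2 > (norm z)\<^sup>2"
      using R by (intro power_strict_mono) auto
    hence "0 < \<Phi> z"
      using pos by (simp add: \<Phi>_def)
    also have "\<Phi> z \<le> \<Phi> a"
      using R by (intro a(2)) auto
    finally have \<Phi>a: "\<Phi> a > 0" .
    hence \<rho>a: "\<rho> a > 0" and "norm a \<noteq> R"
      using nonneg[of a] by (auto simp: \<Phi>_def zero_less_mult_iff)
    with a(1) have aR: "norm a < R"
      by auto
    hence aR2: "(norm a)\<^sup>2 < R\<^sup>2"
      by (intro power_strict_mono) auto
    obtain u g L where u: "\<forall>\<^sub>F w in nhds a. \<rho> w = exp (u w)" "grad_laplacian u a g L" "K * \<rho> a \<le> L"
      using curv[OF \<rho>a] by blast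
    define v where "v = (\<lambda>w::complex. ln (R\<^sup>2 - (norm w)\<^sup>2))"
    define d where "d = R\<^sup>2 - (norm a)\<^sup>2"
    have d: "d > 0"
      using aR2 by (simp add: d_def)
    have "grad_laplacian (\<lambda>w. (norm w)\<^sup>2) a (2 * a) 4"
      using grad_laplacian_norm_square[of "\<lambda>w. w" a] by simp
    from grad_laplacian_add[OF grad_laplacian_const[of "R\<^sup>2"] grad_laplacian_scale[OF this, of "-1"]]
    have "grad_laplacian (\<lambda>w. R\<^sup>2 - (norm w)\<^sup>2) a (- 2 * a) (- 4)"
      by simp
    from grad_laplacian_ln[OF this] aR2
    have "grad_laplacian v a (of_real (1 / d) * (- 2 * a)) (- 4 / d - 4 * (norm a)\<^sup>2 / d\<^sup>2)"
      unfolding v_def d_def by (simp add: norm_mult power_mult_distrib)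
    from grad_laplacian_add[OF u(2) grad_laplacian_scale[OF this, of 2]]
    have "grad_laplacian (\<lambda>w. u w + 2 * v w) a (g + of_real 2 * (of_real (1 / d) * (- 2 * a)))
             (L + 2 * (- 4 / d - 4 * (norm a)\<^sup>2 / d\<^sup>2))" .
    moreover have "\<forall>\<^sub>F w in nhds a. u w + 2 * v w \<le> u a + 2 * v a"
    proof -
      have "\<forall>\<^sub>F w in nhds a. w \<in> ball 0 R"
        using aR by (intro eventually_nhds_in_open) auto
      with u(1) show ?thesis
      proof eventually_elim
        case (elim w)
        have exp_eq: "exp (u x + 2 * v x) = \<Phi> x" if "norm x < R" "\<rho> x = exp (u x)" for x
        proof -
          have "(norm x)\<^sup>2 < R\<^sup>2"
            using that by (intro power_strict_mono) auto
          hence "exp (2 * v x) = (R\<^sup>2 - (norm x)\<^sup>2)\<^sup>2"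
            by (simp add: v_def exp_double)
          thus ?thesis
            using that by (simp add: \<Phi>_def exp_add)
        qed
        have "\<Phi> w \<le> \<Phi> a"
          using elim by (intro a(2)) auto
        hence "exp (u w + 2 * v w) \<le> exp (u a + 2 * v a)"
          using exp_eq[of w] exp_eq[of a] elim aR eventually_nhds_x_imp_x[OF u(1)] by simp
        thus ?case
          by simp
      qed
    qed
    ultimately have "L + 2 * (- 4 / d - 4 * (norm a)\<^sup>2 / d\<^sup>2) \<le> 0"
      by (rule grad_laplacian_local_max)
    hence "K * \<rho> a \<le> 8 / d + 8 * (norm a)\<^sup>2 / d\<^sup>2"
      using u(3) by simp
    also have "\<dots> = 8 * R\<^sup>2 / d\<^sup>2"
    proof -
      have "R\<^sup>2 = d + (norm a)\<^sup>2"
        by (simp add: d_def)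
      thus ?thesis
        using d by (simp add: field_simps power2_eq_square)
    qed
    finally have "\<Phi> a \<le> 8 * R\<^sup>2 / K"
      using d K unfolding \<Phi>_def d_def[symmetric] by (simp add: field_simps)
    with a(2)[of z] R show ?thesis
      by (auto simp: \<Phi>_def)
  qed
  \<comment> \<open>With \<open>R\<^sup>2 = T \<ge> 2 |z|\<^sup>2\<close> the bound gives \<open>\<rho> z * T / 4 \<le> 8 / K\<close>, which fails once \<open>T > 32 / (K * \<rho> z)\<close>.\<close>
  define T where "T = 2 * (norm z)\<^sup>2 + 1 + 32 / (K * \<rho> z)"
  have T: "T > 32 / (K * \<rho> z)" "T \<ge> 2 * (norm z)\<^sup>2" "T > 0"
    using pos K by (auto simp: T_def add_nonneg_pos add_pos_nonneg)
  have "norm z < sqrt T"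
    using T by (intro real_less_rsqrt) (simp add: T_def add_nonneg_pos)
  from bound[OF this] have "\<rho> z * (T - (norm z)\<^sup>2)\<^sup>2 \<le> 8 * T / K"
    using T by simp
  moreover have "(T / 2)\<^sup>2 \<le> (T - (norm z)\<^sup>2)\<^sup>2"
    using T by (intro power_mono) auto
  ultimately have "\<rho> z * (T / 2)\<^sup>2 \<le> 8 * T / K"
    using pos by (meson mult_left_mono order.trans less_imp_le)
  hence "T \<le> 32 / (K * \<rho> z)"
    using T pos K by (simp add: field_simps power2_eq_square)
  with T show False
    by simp
qed

section \<open>The Fermat curve of degree at least four\<close>

text \<open>
  Applied to derivatives, this produces the pull-back \<open>\<eta>\<close> of the residue differential of a plane
  curve, the differential of one coordinate divided by the partial derivative in the other: each of
  the two quotients describes it on one chart, and no singularity has to be removed because the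
  charts cover the plane.
\<close>

lemma entire_common_ratio:
  assumes hol: "a holomorphic_on UNIV" "b holomorphic_on UNIV" "p holomorphic_on UNIV" "q holomorphic_on UNIV"
    and eq: "\<And>z. a z * q z = b z * p z" and nz: "\<And>z. p z \<noteq> 0 \<or> q z \<noteq> 0"
  obtains \<eta> where "\<eta> holomorphic_on UNIV" "\<And>z::complex. a z = \<eta> z * p z" "\<And>z. b z = \<eta> z * q z"
proof
  define \<eta> where "\<eta> = (\<lambda>z. if p z \<noteq> 0 then a z / p z else b z / q z)"
  show "a z = \<eta> z * p z" for z
    using eq[of z] nz[of z] by (auto simp: \<eta>_def)
  show "b z = \<eta> z * q z" for z
    using eq[of z] nz[of z] by (auto simp: \<eta>_def field_simps)
  have op: "open {z. p z \<noteq> 0}" "open {z. q z \<noteq> 0}"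
    using hol by (auto intro!: open_Collect_neq holomorphic_on_imp_continuous_on)
  have "\<eta> holomorphic_on {z. p z \<noteq> 0}"
    by (rule holomorphic_transform[of "\<lambda>z. a z / p z"])
       (auto simp: \<eta>_def intro!: holomorphic_intros hol[THEN holomorphic_on_subset])
  moreover have "\<eta> holomorphic_on {z. q z \<noteq> 0}"
    by (rule holomorphic_transform[of "\<lambda>z. b z / q z"])
       (use eq in \<open>auto simp: \<eta>_def field_simps intro!: holomorphic_intros hol[THEN holomorphic_on_subset]\<close>)
  ultimately have "\<eta> holomorphic_on {z. p z \<noteq> 0} \<union> {z. q z \<noteq> 0}"
    using op by (intro holomorphic_on_Un)
  moreover have "{z. p z \<noteq> 0} \<union> {z. q z \<noteq> 0} = UNIV"
    using nz by auto
  ultimately show "\<eta> holomorphic_on UNIV"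
    by simp
qed

text \<open>
  The logarithm of the modulus of a holomorphic function is harmonic, so a factor \<open>|\<eta>|\<^sup>2\<close> in a metric
  does not contribute to its curvature.
\<close>

lemma grad_laplacian_ln_norm_square:
  assumes "F holomorphic_on UNIV" and "F z \<noteq> 0"
  shows "\<exists>g. grad_laplacian (\<lambda>w. ln ((norm (F w))\<^sup>2)) z g 0"
proof -
  have "(norm (2 * F z * cnj (deriv F z)))\<^sup>2 = 4 * (norm (F z))\<^sup>2 * (norm (deriv F z))\<^sup>2"
    by (simp add: norm_mult power_mult_distrib)
  thus ?thesis
    using grad_laplacian_ln[OF grad_laplacian_norm_square[OF assms(1), of z]] assms(2)
    by (intro exI) (auto simp: field_simps power2_eq_square)
qed

lemma lagrange_identity_3:
  fixes a b c a' b' c' :: complex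
  shows "((norm a)\<^sup>2 + (norm b)\<^sup>2 + (norm c)\<^sup>2) * ((norm a')\<^sup>2 + (norm b')\<^sup>2 + (norm c')\<^sup>2)
          - (norm (a * cnj a' + b * cnj b' + c * cnj c'))\<^sup>2
        = (norm (b * c' - c * b'))\<^sup>2 + (norm (c * a' - a * c'))\<^sup>2 + (norm (a * b' - b * a'))\<^sup>2"
  unfolding cmod_power2 by simp algebra

text \<open>
  This Laplacian is, up to a constant, the pull-back of the Fubini-Study metric along
  \<open>[X : Y : Z]\<close>, written through the cross product of \<open>(X, Y, Z)\<close> with its derivative by means of
  Lagrange's identity.
\<close>

lemma grad_laplacian_ln_sum_norm_squares:
  fixes X Y Z :: "complex \<Rightarrow> complex"
  assumes "X holomorphic_on UNIV" "Y holomorphic_on UNIV" "Z holomorphic_on UNIV"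
  defines "S \<equiv> (\<lambda>w. (norm (X w))\<^sup>2 + (norm (Y w))\<^sup>2 + (norm (Z w))\<^sup>2)"
  assumes "S z > 0"
  shows "\<exists>g. grad_laplacian (\<lambda>w. ln (S w)) z g
           (4 * ((norm (Y z * deriv Z z - Z z * deriv Y z))\<^sup>2
               + (norm (Z z * deriv X z - X z * deriv Z z))\<^sup>2
               + (norm (X z * deriv Y z - Y z * deriv X z))\<^sup>2) / (S z)\<^sup>2)"
proof -
  define T where "T = (norm (deriv X z))\<^sup>2 + (norm (deriv Y z))\<^sup>2 + (norm (deriv Z z))\<^sup>2"
  define h where "h = X z * cnj (deriv X z) + Y z * cnj (deriv Y z) + Z z * cnj (deriv Z z)"
  have "grad_laplacian S z (2 * h) (4 * T)"
    using grad_laplacian_add[OF grad_laplacian_add[OF grad_laplacian_norm_square[OF assms(1)] grad_laplacian_norm_square[OF assms(2)]]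
        grad_laplacian_norm_square[OF assms(3)], of z]
    unfolding S_def T_def h_def by (simp add: algebra_simps)
  from grad_laplacian_ln[OF this \<open>S z > 0\<close>]
  have "grad_laplacian (\<lambda>w. ln (S w)) z (of_real (1 / S z) * (2 * h)) (4 * T / S z - (norm (2 * h))\<^sup>2 / (S z)\<^sup>2)" .
  moreover have "4 * T / S z - (norm (2 * h))\<^sup>2 / (S z)\<^sup>2 = 4 * (S z * T - (norm h)\<^sup>2) / (S z)\<^sup>2"
    using \<open>S z > 0\<close> by (simp add: norm_mult power_mult_distrib field_simps power2_eq_square)
  ultimately show ?thesis
    using lagrange_identity_3[of "X z" "Y z" "Z z" "deriv X z" "deriv Y z" "deriv Z z"]
    unfolding S_def T_def h_def by auto
qed

lemma power_sum_three_le: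
  fixes a b c :: real
  assumes "a \<ge> 0" "b \<ge> 0" "c \<ge> 0"
  shows "(a + b + c) ^ k \<le> 3 ^ k * (a ^ k + b ^ k + c ^ k)"
proof -
  define M where "M = max a (max b c)"
  have "(a + b + c) ^ k \<le> (3 * M) ^ k"
    using assms by (intro power_mono) (auto simp: M_def)
  also have "\<dots> = 3 ^ k * M ^ k"
    by (simp add: power_mult_distrib)
  also have "M ^ k \<le> a ^ k + b ^ k + c ^ k"
    using assms by (auto simp: M_def max_def)
  finally show ?thesis
    by simp
qed


text \<open>
  The quotient \<open>X / Z\<close> has derivative 0 near \<open>z0\<close>; the identity theorem carries the linear relation
  to the zeros of \<open>Z\<close>.
\<close>

lemma wronskian_zero_imp_proportional:
  fixes X Z :: "complex \<Rightarrow> complex"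
  assumes hol: "X holomorphic_on UNIV" "Z holomorphic_on UNIV"
    and W: "\<And>z. deriv X z * Z z = X z * deriv Z z" and z0: "Z z0 \<noteq> 0"
  shows "X z = X z0 / Z z0 * Z z"
proof -
  define a where "a = X z0 / Z z0"
  have "open {z. Z z \<noteq> 0}"
    using hol by (auto intro!: open_Collect_neq holomorphic_on_imp_continuous_on)
  then obtain r where r: "r > 0" "ball z0 r \<subseteq> {z. Z z \<noteq> 0}"
    using z0 open_contains_ball by blast
  have der: "((\<lambda>z. X z / Z z) has_field_derivative 0) (at w within ball z0 r)" if "w \<in> ball z0 r" for w
  proof -
    have "(X has_field_derivative deriv X w) (at w)" "(Z has_field_derivative deriv Z w) (at w)"
      using hol by (auto intro: holomorphic_derivI)
    hence "((\<lambda>z. X z / Z z) has_field_derivative (deriv X w * Z w - X w * deriv Z w) / (Z w * Z w)) (at w)"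
      using that r by (intro DERIV_divide) auto
    thus ?thesis
      using W[of w] by (simp add: has_field_derivative_at_within)
  qed
  have eq: "X w - a * Z w = 0" if w: "w \<in> ball z0 r" for w
  proof -
    have "X w / Z w = X z0 / Z z0"
      using has_field_derivative_zero_constant[of "ball z0 r" "\<lambda>z. X z / Z z"] der w r(1)
      by (metis centre_in_ball convex_ball)
    thus ?thesis
      using w r z0 by (auto simp: a_def field_simps)
  qed
  have "X z - a * Z z = 0"
    by (rule analytic_continuation[of "\<lambda>z. X z - a * Z z" UNIV "ball z0 r" z0 z])
       (use hol r(1) eq in \<open>auto intro!: holomorphic_intros islimpt_ball simp: Convex.connected_UNIV\<close>)
  thus ?thesis
    by (simp add: a_def)
qed

text \<open>
  A vector \<open>(p, q, -r)\<close> orthogonal to both \<open>(a, b, c)\<close> and \<open>(a', b', c')\<close> is parallel to their cross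
  product. With the position and the velocity on the Fermat curve as the two vectors and the gradient
  of \<open>X\<^sup>n + Y\<^sup>n - Z\<^sup>n\<close> as the third, the common ratio is the residue differential in homogeneous
  coordinates.
\<close>

lemma cross_product_orthogonal:
  fixes a b c a' b' c' p q r :: complex
  assumes "p * a' + q * b' = r * c'" and "p * a + q * b = r * c"
  shows "(b * c' - c * b') * q = (c * a' - a * c') * p"
    and "(a * b' - b * a') * p = - r * (b * c' - c * b')"
    and "(a * b' - b * a') * q = - r * (c * a' - a * c')"
  using assms by algebra+

text \<open>
  The Fermat curve of degree \<open>n \<ge> 4\<close> has genus at least 2, so entire curves in it are constant. With
  \<open>k = n - 1\<close> the cross product of \<open>(X, Y, Z)\<close> with its derivative is \<open>\<eta> (X\<^sup>k, Y\<^sup>k, - Z\<^sup>k)\<close>, and with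
  \<open>S = |X|\<^sup>2 + |Y|\<^sup>2 + |Z|\<^sup>2\<close> the metric \<open>|\<eta>|\<^sup>2 S^(k - 2)\<close> has log-Laplacian
  \<open>4 (k - 2) |\<eta>|\<^sup>2 (|X|^(2 k) + |Y|^(2 k) + |Z|^(2 k)) / S\<^sup>2\<close>. The bracket dominates \<open>S^k\<close> up to the factor
  \<open>3^k\<close>, so the curvature is bounded above by a negative constant. Positivity of \<open>k - 2\<close> is where
  degree 3, the case of elliptic curves, drops out.
\<close>

lemma fermat_curve_proportional:
  fixes X Y Z :: "complex \<Rightarrow> complex"
  assumes hol: "X holomorphic_on UNIV" "Y holomorphic_on UNIV" "Z holomorphic_on UNIV"
    and n: "n \<ge> 4"
    and eq: "\<And>z. X z ^ n + Y z ^ n = Z z ^ n"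
    and nz: "\<And>z. X z \<noteq> 0 \<or> Z z \<noteq> 0"
    and z0: "Z z0 \<noteq> 0"
  shows "X z = X z0 / Z z0 * Z z"
proof -
  have der: "X z ^ (n - 1) * deriv X z + Y z ^ (n - 1) * deriv Y z = Z z ^ (n - 1) * deriv Z z" for z
  proof -
    have pw: "((\<lambda>z. F z ^ n) has_field_derivative of_nat n * (F z ^ (n - 1) * deriv F z)) (at z)"
      if "F holomorphic_on UNIV" for F
      using that by (auto intro!: derivative_eq_intros holomorphic_derivI)
    have "((\<lambda>z. Z z ^ n) has_field_derivative of_nat n * (X z ^ (n - 1) * deriv X z)
            + of_nat n * (Y z ^ (n - 1) * deriv Y z)) (at z)"
      using DERIV_add[OF pw[OF hol(1)] pw[OF hol(2)]] by (simp add: eq)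
    from DERIV_unique[OF this pw[OF hol(3)]] show ?thesis
      using n by (simp flip: distrib_left)
  qed
  obtain k where k: "n = Suc k" "k \<ge> 3"
    using n by (cases n) auto
  have "X z ^ k * deriv X z + Y z ^ k * deriv Y z = Z z ^ k * deriv Z z"
    "X z ^ k * X z + Y z ^ k * Y z = Z z ^ k * Z z" for z
    using der[of z] eq[of z] by (simp_all add: k mult.commute)
  note cross = cross_product_orthogonal[OF this]
  define A1 A2 A3 where "A1 = (\<lambda>z. Y z * deriv Z z - Z z * deriv Y z)"
    and "A2 = (\<lambda>z. Z z * deriv X z - X z * deriv Z z)"
    and "A3 = (\<lambda>z. X z * deriv Y z - Y z * deriv X z)"
  have XY: "X z \<noteq> 0 \<or> Y z \<noteq> 0" for z
    using eq[of z] nz[of z] k by auto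
  have "A1 holomorphic_on UNIV" "A2 holomorphic_on UNIV"
    unfolding A1_def A2_def using hol by (auto intro!: holomorphic_intros holomorphic_deriv)
  moreover have "A1 z * Y z ^ k = A2 z * X z ^ k" for z
    using cross(1)[of z] by (simp add: A1_def A2_def)
  ultimately obtain \<eta> where \<eta>: "\<eta> holomorphic_on UNIV" "\<And>z. A1 z = \<eta> z * X z ^ k" "\<And>z. A2 z = \<eta> z * Y z ^ k"
    using XY hol k
    by (elim entire_common_ratio[of A1 A2 "\<lambda>z. X z ^ k" "\<lambda>z. Y z ^ k"]) (auto intro!: holomorphic_intros)
  have \<eta>3: "A3 z = - \<eta> z * Z z ^ k" for z
  proof -
    have "A3 z * X z ^ k = - (Z z ^ k) * A1 z" "A3 z * Y z ^ k = - (Z z ^ k) * A2 z"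
      using cross(2,3)[of z] by (simp_all add: A1_def A2_def A3_def)
    hence "(A3 z + \<eta> z * Z z ^ k) * X z ^ k = 0" "(A3 z + \<eta> z * Z z ^ k) * Y z ^ k = 0"
      by (simp_all add: \<eta> algebra_simps)
    thus ?thesis
      using XY[of z] by (auto simp: add_eq_0_iff)
  qed
  define S where "S = (\<lambda>z. (norm (X z))\<^sup>2 + (norm (Y z))\<^sup>2 + (norm (Z z))\<^sup>2)"
  have S: "S z > 0" for z
    using nz[of z] unfolding S_def by (auto simp: add_pos_nonneg add_nonneg_pos)
  define \<rho> where "\<rho> = (\<lambda>z. (norm (\<eta> z))\<^sup>2 * S z ^ (k - 2))"
  have "\<rho> z = 0" for z
  proof (rule ahlfors_schwarz_plane[of \<rho> "4 * (k - 2) / 3 ^ k"])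
    show "continuous_on UNIV \<rho>"
      unfolding \<rho>_def S_def using hol \<eta>(1)
      by (intro continuous_intros holomorphic_on_imp_continuous_on)
    show "\<rho> z \<ge> 0" for z
      using S[of z] by (simp add: \<rho>_def)
    show "4 * (k - 2) / 3 ^ k > (0::real)"
      using k by simp
  next
    fix z assume "\<rho> z > 0"
    hence \<eta>z: "\<eta> z \<noteq> 0"
      by (auto simp: \<rho>_def)
    define L where "L = 4 * ((norm (A1 z))\<^sup>2 + (norm (A2 z))\<^sup>2 + (norm (A3 z))\<^sup>2) / (S z)\<^sup>2"
    obtain g where g: "grad_laplacian (\<lambda>w. ln ((norm (\<eta> w))\<^sup>2)) z g 0"
      using grad_laplacian_ln_norm_square[OF \<eta>(1) \<eta>z] by blast
    obtain h where h: "grad_laplacian (\<lambda>w. ln (S w)) z h L"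
      using grad_laplacian_ln_sum_norm_squares[OF hol] S[of z]
      unfolding S_def L_def A1_def A2_def A3_def by blast
    define u where "u = (\<lambda>w. ln ((norm (\<eta> w))\<^sup>2) + (k - 2) * ln (S w))"
    have "grad_laplacian u z (g + of_real (k - 2) * h) (0 + (k - 2) * L)"
      unfolding u_def by (intro grad_laplacian_add g grad_laplacian_scale h)
    moreover have "\<forall>\<^sub>F w in nhds z. \<rho> w = exp (u w)"
    proof -
      have "open {w. \<eta> w \<noteq> 0}"
        using \<eta>(1) by (auto intro!: open_Collect_neq holomorphic_on_imp_continuous_on)
      hence "\<forall>\<^sub>F w in nhds z. w \<in> {w. \<eta> w \<noteq> 0}"
        using \<eta>z by (intro eventually_nhds_in_open) auto
      thus ?thesis
        by eventually_elim (use S in \<open>simp add: \<rho>_def u_def exp_add exp_of_nat_mult\<close>)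
    qed
    moreover have "4 * (k - 2) / 3 ^ k * \<rho> z \<le> 0 + (k - 2) * L"
    proof -
      have "k - 2 + 2 = k"
        using k by simp
      hence "S z ^ (k - 2) * (S z)\<^sup>2 = S z ^ k"
        by (simp only: power_add[symmetric])
      also have "\<dots> \<le> 3 ^ k * (((norm (X z))\<^sup>2) ^ k + ((norm (Y z))\<^sup>2) ^ k + ((norm (Z z))\<^sup>2) ^ k)"
        unfolding S_def by (rule power_sum_three_le) auto
      finally have "(norm (\<eta> z))\<^sup>2 * (S z ^ (k - 2) * (S z)\<^sup>2) \<le> 3 ^ k * ((norm (\<eta> z))\<^sup>2 *
           (((norm (X z))\<^sup>2) ^ k + ((norm (Y z))\<^sup>2) ^ k + ((norm (Z z))\<^sup>2) ^ k))"
        by (metis mult.left_commute mult_left_mono zero_le_power2)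
      also have "(norm (\<eta> z))\<^sup>2 * (((norm (X z))\<^sup>2) ^ k + ((norm (Y z))\<^sup>2) ^ k + ((norm (Z z))\<^sup>2) ^ k)
          = (norm (A1 z))\<^sup>2 + (norm (A2 z))\<^sup>2 + (norm (A3 z))\<^sup>2"
        unfolding \<eta>(2,3) \<eta>3
        by (simp add: norm_mult norm_power power_mult_distrib algebra_simps flip: power_mult)
      finally have "\<rho> z / 3 ^ k \<le> L / 4"
        using S[of z] unfolding \<rho>_def L_def by (simp add: field_simps)
      hence "(4 * (k - 2)) * (\<rho> z / 3 ^ k) \<le> (4 * (k - 2)) * (L / 4)"
        by (intro mult_left_mono) auto
      thus ?thesis
        by simp
    qed
    ultimately show "\<exists>u g L. (\<forall>\<^sub>F w in nhds z. \<rho> w = exp (u w)) \<and> grad_laplacian u z g L \<and> 4 * (k - 2) / 3 ^ k * \<rho> z \<le> L"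
      by blast
  qed
  hence "\<eta> z = 0" for z
    using S[of z] by (force simp: \<rho>_def)
  hence "A2 z = 0" for z
    by (simp add: \<eta>)
  thus ?thesis
    using hol(1,3) z0 by (intro wronskian_zero_imp_proportional) (auto simp: A2_def algebra_simps)
qed

section \<open>Entire solutions of the affine equation\<close>

text \<open>
  The factor \<open>1 + (1 + |F|\<^sup>2)^s\<close> grows only like a small power of \<open>|F|\<close>, and its log-Laplacian does not
  decay as fast as the Fubini-Study form of \<open>F\<close>: for \<open>s < 1\<close> and large \<open>|F|\<close> it is of the order \<open>|F'|\<^sup>2 |F|^(- 2 - 2 s)\<close>
  rather than \<open>|F'|\<^sup>2 |F|^(- 4)\<close>. That is what makes negative curvature possible near the points at
  infinity of the affine curve.
\<close>

lemma grad_laplacian_ln_one_plus_powr: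
  fixes F :: "complex \<Rightarrow> complex"
  assumes F: "F holomorphic_on UNIV" and s: "0 < s" "s \<le> 1"
  shows "\<exists>g L. grad_laplacian (\<lambda>w. ln (1 + (1 + (norm (F w))\<^sup>2) powr s)) z g L \<and>
           s\<^sup>2 * (norm (deriv F z))\<^sup>2 * (1 + (norm (F z))\<^sup>2) powr (- 1 - s) \<le> L"
proof -
  define x where "x = (norm (F z))\<^sup>2"
  \<comment> \<open>The derivatives of \<open>ln (1 + (1 + x) powr s)\<close> are rational in \<open>s\<close>, \<open>x\<close> and \<open>E\<close>.\<close>
  define E where "E = (1 + x) powr s"
  have x: "x \<ge> 0"
    by (simp add: x_def)
  hence E: "E \<ge> 1"
    using s unfolding E_def by (intro ge_one_powr_ge_zero) auto
  define h' where "h' = (\<lambda>x::real. s * (1 + x) powr s / ((1 + x) * (1 + (1 + x) powr s)))"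
  define h2 where "h2 = s * E * (s - 1 - E) / ((1 + x)\<^sup>2 * (1 + E)\<^sup>2)"
  have "\<forall>\<^sub>F y in nhds x. y \<in> {-1<..}"
    using x by (intro eventually_nhds_in_open) auto
  hence "\<forall>\<^sub>F y in nhds x. ((\<lambda>y. ln (1 + (1 + y) powr s)) has_real_derivative h' y) (at y)"
  proof eventually_elim
    case (elim y)
    have "1 + (1 + y) powr s > 0"
      by (simp add: add_pos_nonneg)
    with elim show ?case
      by (auto intro!: derivative_eq_intros simp: h'_def powr_diff)
  qed
  moreover have "(h' has_real_derivative h2) (at x)"
  proof -
    have pw: "((\<lambda>y. (1 + y) powr s) has_real_derivative s * E / (1 + x)) (at x)"
      using x by (auto intro!: derivative_eq_intros simp: E_def powr_diff)
    have "(h' has_real_derivative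
        ((s * (s * E / (1 + x))) * ((1 + x) * (1 + E)) - s * E * (1 * (1 + E) + s * E / (1 + x) * (1 + x)))
          / (((1 + x) * (1 + E)) * ((1 + x) * (1 + E)))) (at x)"
      unfolding h'_def E_def
    proof (intro DERIV_divide DERIV_cmult DERIV_mult pw[unfolded E_def])
      show "((\<lambda>y. 1 + y) has_real_derivative 1) (at x)"
        by (auto intro!: derivative_eq_intros)
      show "((\<lambda>y. 1 + (1 + y) powr s) has_real_derivative s * (1 + x) powr s / (1 + x)) (at x)"
        using DERIV_add[OF DERIV_const[of 1] pw] by (simp add: E_def)
      show "(1 + x) * (1 + (1 + x) powr s) \<noteq> 0"
        using x E by (simp add: E_def)
    qed
    also have "((s * (s * E / (1 + x))) * ((1 + x) * (1 + E)) - s * E * (1 * (1 + E) + s * E / (1 + x) * (1 + x)))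
          / (((1 + x) * (1 + E)) * ((1 + x) * (1 + E))) = h2"
    proof -
      have "(s * (s * E / (1 + x))) * ((1 + x) * (1 + E)) - s * E * (1 * (1 + E) + s * E / (1 + x) * (1 + x))
          = s * E * (s - 1 - E)"
        using x by simp (simp add: algebra_simps)
      thus ?thesis
        by (simp add: h2_def power2_eq_square mult_ac)
    qed
    finally show ?thesis .
  qed
  ultimately have "grad_laplacian (\<lambda>w. ln (1 + (1 + (norm (F w))\<^sup>2) powr s)) z
       (of_real (h' x) * (2 * F z * cnj (deriv F z)))
       (h' x * (4 * (norm (deriv F z))\<^sup>2) + h2 * (norm (2 * F z * cnj (deriv F z)))\<^sup>2)"
    using grad_laplacian_compose[OF grad_laplacian_norm_square[OF F, of z], of "\<lambda>y. ln (1 + (1 + y) powr s)" h' h2]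
    by (simp add: x_def)
  moreover have "s\<^sup>2 * (norm (deriv F z))\<^sup>2 * (1 + x) powr (- 1 - s) \<le>
      h' x * (4 * (norm (deriv F z))\<^sup>2) + h2 * (norm (2 * F z * cnj (deriv F z)))\<^sup>2"
  proof -
    have pw: "(1 + x) powr (- 1 - s) = 1 / ((1 + x) * E)"
      using x by (simp add: E_def powr_diff powr_minus divide_simps)
    have "s\<^sup>2 / (q * E) = 4 * (s * E * (s * q) / (q\<^sup>2 * (2 * E)\<^sup>2))" if "q > 0" for q
      using that E by (simp add: field_simps power2_eq_square)
    hence "s\<^sup>2 / ((1 + x) * E) = 4 * (s * E * (s * (1 + x)) / ((1 + x)\<^sup>2 * (2 * E)\<^sup>2))"
      using x by simp
    also have "\<dots> \<le> 4 * (s * E * (s * x + 1 + E) / ((1 + x)\<^sup>2 * (1 + E)\<^sup>2))"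
      using x E s by (intro mult_left_mono frac_le mult_mono power_mono) (auto simp: algebra_simps)
    also have "s * E * (s * x + 1 + E) / ((1 + x)\<^sup>2 * (1 + E)\<^sup>2) = h' x + x * h2"
      using x E unfolding h'_def h2_def E_def[symmetric]
      by (simp add: divide_simps power2_eq_square) (simp add: algebra_simps)
    finally have "(norm (deriv F z))\<^sup>2 * (s\<^sup>2 / ((1 + x) * E)) \<le> (norm (deriv F z))\<^sup>2 * (4 * (h' x + x * h2))"
      by (rule mult_left_mono) auto
    thus ?thesis
      unfolding pw by (simp add: norm_mult power_mult_distrib x_def algebra_simps)
  qed
  ultimately show ?thesis
    unfolding x_def by blast
qed

text \<open>
  With \<open>a = |F|\<close> and \<open>b = |G|\<close>: on the part of the curve where \<open>|F|\<^sup>n\<close> dominates, it is at least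
  \<open>1 / 2\<close> because \<open>1 \<le> |F|\<^sup>n + |G|^m\<close>, and \<open>|G|\<close> is at most of the order of \<open>|F|^(n / m)\<close>. Comparing
  exponents of \<open>|F|\<close>, the curvature estimate reduces to \<open>s (m + 2 n) \<le> m (n - 1) - n\<close>, which leaves room for
  a positive \<open>s\<close> exactly when \<open>1 / n + 1 / m < 1\<close>.
\<close>

lemma powr_growth_bound:
  fixes s :: real
  assumes n: "n \<ge> 1" and m: "m \<ge> 1" and s: "s > 0" "s * (m + 2 * n) \<le> real m * (real n - 1) - n"
  obtains C where "C > 0" "\<And>a b :: real. \<lbrakk>a \<ge> 0; b \<ge> 0; a ^ n \<ge> 1 / 2; b ^ m \<le> a ^ n\<rbrakk> \<Longrightarrow>
     (1 + a\<^sup>2) powr s * (1 + b\<^sup>2) powr (1 + 2 * s) \<le> C * (a\<^sup>2) ^ (n - 1)"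
proof
  define p where "p = 2 * real n / m"
  \<comment> \<open>\<open>p\<close> is the growth exponent of \<open>b\<^sup>2\<close> in terms of \<open>a\<close>, and \<open>e\<close> the surplus of the right-hand side.\<close>
  define e where "e = 2 * (real n - 1) - 2 * s - p * (1 + 2 * s)"
  have "m * e = 2 * (real m * (real n - 1) - n - s * (real m + 2 * real n))"
    using m by (simp add: e_def p_def field_simps)
  also have "\<dots> \<ge> 0"
    using s(2) by simp
  finally have "m * e \<ge> 0" .
  hence e: "e \<ge> 0"
    using m by (simp add: zero_le_mult_iff)
  show "5 powr s * 5 powr (1 + 2 * s) * (1 / 2) powr (- e) > 0"
    by simp
  fix a b :: real
  assume ab: "a \<ge> 0" "b \<ge> 0" "a ^ n \<ge> 1 / 2" "b ^ m \<le> a ^ n"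
  have a: "a \<ge> 1 / 2"
  proof (rule ccontr)
    assume "\<not> a \<ge> 1 / 2"
    hence "a ^ n \<le> a ^ 1"
      using n ab by (intro power_decreasing) auto
    with ab(3) \<open>\<not> a \<ge> 1 / 2\<close> show False
      by simp
  qed
  have pw: "(a ^ n) powr (2 / m) = a powr p"
    using a by (simp add: p_def powr_powr mult_ac flip: powr_realpow)
  have "1 \<le> (2 * a ^ n) powr (2 / m)"
    using ab by (intro ge_one_powr_ge_zero) auto
  also have "\<dots> = 2 powr (2 / m) * a powr p"
    using a pw by (simp add: powr_mult)
  also have "\<dots> \<le> 2 powr 2 * a powr p"
    using m by (intro mult_right_mono powr_mono) (auto simp: field_simps)
  finally have "1 \<le> 4 * a powr p"
    by simp
  moreover have "b\<^sup>2 \<le> a powr p"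
  proof (cases "b = 0")
    case False
    hence "b\<^sup>2 = (b ^ m) powr (2 / m)"
    proof -
      have "b > 0" "(b ^ m) powr (2 / m) = (b powr m) powr (2 / m)"
        using False ab(2) by (simp_all add: powr_realpow)
      thus ?thesis
        using m by (simp add: powr_powr)
    qed
    also have "\<dots> \<le> (a ^ n) powr (2 / m)"
      using ab by (intro powr_mono2) auto
    finally show ?thesis
      by (simp add: pw)
  qed auto
  ultimately have "1 + b\<^sup>2 \<le> 5 * a powr p"
    by simp
  moreover have "(1 / 2)\<^sup>2 \<le> a\<^sup>2"
    using a by (intro power_mono) auto
  hence "1 + a\<^sup>2 \<le> 5 * a powr 2"
    using a by (simp add: power2_eq_square)
  ultimately have "(1 + a\<^sup>2) powr s * (1 + b\<^sup>2) powr (1 + 2 * s)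
      \<le> (5 * a powr 2) powr s * (5 * a powr p) powr (1 + 2 * s)"
    using s by (intro mult_mono powr_mono2) (auto simp: add_nonneg_nonneg)
  also have "\<dots> = 5 powr s * 5 powr (1 + 2 * s) * a powr (2 * (real n - 1) + (- e))"
  proof -
    have "(5 * a powr 2) powr s = 5 powr s * a powr (2 * s)"
      and "(5 * a powr p) powr (1 + 2 * s) = 5 powr (1 + 2 * s) * a powr (p * (1 + 2 * s))"
      by (simp_all add: powr_mult powr_powr)
    moreover have "a powr (2 * s) * a powr (p * (1 + 2 * s)) = a powr (2 * (real n - 1) + (- e))"
      by (simp add: e_def add.commute flip: powr_add)
    ultimately show ?thesis
      by (simp only: mult.assoc mult.left_commute[of "a powr _"])
  qed
  also have "\<dots> = 5 powr s * 5 powr (1 + 2 * s) * a powr (- e) * a powr (2 * (real n - 1))"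
    by (simp only: powr_add mult_ac)
  also have "a powr (2 * (real n - 1)) = (a\<^sup>2) ^ (n - 1)"
  proof -
    have "2 * (real n - 1) = real (2 * (n - 1))"
      using n by (simp add: of_nat_diff)
    moreover have "a > 0"
      using a by simp
    ultimately show ?thesis
      by (simp only: powr_realpow power_mult)
  qed
  also have "5 powr s * 5 powr (1 + 2 * s) * a powr (- e) * (a\<^sup>2) ^ (n - 1)
     \<le> 5 powr s * 5 powr (1 + 2 * s) * (1 / 2) powr (- e) * (a\<^sup>2) ^ (n - 1)"
    using a e by (intro mult_right_mono mult_left_mono powr_mono2') auto
  finally show "(1 + a\<^sup>2) powr s * (1 + b\<^sup>2) powr (1 + 2 * s)
     \<le> 5 powr s * 5 powr (1 + 2 * s) * (1 / 2) powr (- e) * (a\<^sup>2) ^ (n - 1)" .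
qed

text \<open>
  The affine curve \<open>x\<^sup>n + y\<^sup>m = 1\<close> is hyperbolic even where its completion is elliptic, as for the
  exponents \<open>(2, 3)\<close> and \<open>(2, 4)\<close>, because the points at infinity are missing. The residue
  differential \<open>\<eta>\<close> satisfies \<open>F' = m G^(m-1) \<eta>\<close> and \<open>G' = - n F^(n-1) \<eta>\<close>, and the metric
  \<open>|\<eta>|\<^sup>2 (1 + (1 + |F|\<^sup>2)^s) (1 + (1 + |G|\<^sup>2)^s)\<close> with small \<open>s\<close> has curvature bounded above by a negative
  constant: where \<open>|F|\<^sup>n\<close> dominates, the Laplacian of the factor in \<open>G\<close> is large enough, and vice versa.
\<close>

lemma entire_power_sum_one_constant:
  fixes F G :: "complex \<Rightarrow> complex"
  assumes hol: "F holomorphic_on UNIV" "G holomorphic_on UNIV"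
    and nm: "n \<ge> 2" "m \<ge> 2" "m + n \<ge> 5"
    and eq: "\<And>z. F z ^ n + G z ^ m = 1"
  shows "F constant_on UNIV"
proof -
  have der: "of_nat n * F z ^ (n - 1) * deriv F z + of_nat m * G z ^ (m - 1) * deriv G z = 0" for z
  proof -
    have "((\<lambda>z. F z ^ n + G z ^ m) has_field_derivative
        of_nat n * F z ^ (n - 1) * deriv F z + of_nat m * G z ^ (m - 1) * deriv G z) (at z)"
      using hol by (auto intro!: derivative_eq_intros holomorphic_derivI)
    moreover have "((\<lambda>z. F z ^ n + G z ^ m) has_field_derivative 0) (at z)"
      by (simp add: eq)
    ultimately show ?thesis
      by (rule DERIV_unique)
  qed
  have FG: "F z \<noteq> 0 \<or> G z \<noteq> 0" for z
    using eq[of z] nm by (auto simp: power_0_left)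
  obtain \<eta> where \<eta>: "\<eta> holomorphic_on UNIV" "\<And>z. deriv F z = \<eta> z * (of_nat m * G z ^ (m - 1))"
      "\<And>z. deriv G z = \<eta> z * (- of_nat n * F z ^ (n - 1))"
  proof (rule entire_common_ratio[of "deriv F" "deriv G"
      "\<lambda>z. of_nat m * G z ^ (m - 1)" "\<lambda>z. - of_nat n * F z ^ (n - 1)"])
    show "deriv F z * (- of_nat n * F z ^ (n - 1)) = deriv G z * (of_nat m * G z ^ (m - 1))" for z
    proof -
      have "deriv F z * (- of_nat n * F z ^ (n - 1)) - deriv G z * (of_nat m * G z ^ (m - 1))
          = - (of_nat n * F z ^ (n - 1) * deriv F z + of_nat m * G z ^ (m - 1) * deriv G z)"
        by (simp add: algebra_simps)
      thus ?thesis
        by (simp only: der minus_zero right_minus_eq)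
    qed
    show "of_nat m * G z ^ (m - 1) \<noteq> 0 \<or> - of_nat n * F z ^ (n - 1) \<noteq> 0" for z
      using FG[of z] nm by auto
  qed (use hol in \<open>auto intro!: holomorphic_intros holomorphic_deriv\<close>)
  \<comment> \<open>This makes \<open>s (m + 2 n)\<close> and \<open>s (n + 2 m)\<close> at most 1, while \<open>n m - n - m \<ge> 1\<close>.\<close>
  define s where "s = 1 / (2 * real (n + m))"
  have s: "0 < s" "s \<le> 1"
    using nm by (auto simp: s_def divide_simps)
  have "(n - 1) * (m - 1) \<ge> 2"
  proof (cases "n = 2")
    case False
    hence "2 * 1 \<le> (n - 1) * (m - 1)"
      using nm by (intro mult_le_mono) auto
    thus ?thesis by simp
  qed (use nm in auto)
  hence "real (n - 1) * real (m - 1) \<ge> 2"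
    by (metis of_nat_le_iff of_nat_mult of_nat_numeral)
  moreover have "real (n - 1) = real n - 1" "real (m - 1) = real m - 1"
    using nm by (simp_all add: of_nat_diff)
  ultimately have hyp: "real n * real m - real n - real m \<ge> 1"
    by (simp add: algebra_simps)
  have "s * (real m + 2 * real n) \<le> 1" "s * (real n + 2 * real m) \<le> 1"
    using nm by (auto simp: s_def field_simps)
  hence "s * (real m + 2 * real n) \<le> real m * (real n - 1) - real n"
      "s * (real n + 2 * real m) \<le> real n * (real m - 1) - real m"
    using hyp by (auto simp: algebra_simps)
  then obtain C1 C2 where
    C1: "C1 > 0" "\<And>a b :: real. \<lbrakk>a \<ge> 0; b \<ge> 0; a ^ n \<ge> 1 / 2; b ^ m \<le> a ^ n\<rbrakk> \<Longrightarrow>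
     (1 + a\<^sup>2) powr s * (1 + b\<^sup>2) powr (1 + 2 * s) \<le> C1 * (a\<^sup>2) ^ (n - 1)" and
    C2: "C2 > 0" "\<And>a b :: real. \<lbrakk>a \<ge> 0; b \<ge> 0; a ^ m \<ge> 1 / 2; b ^ n \<le> a ^ m\<rbrakk> \<Longrightarrow>
     (1 + a\<^sup>2) powr s * (1 + b\<^sup>2) powr (1 + 2 * s) \<le> C2 * (a\<^sup>2) ^ (m - 1)"
    using powr_growth_bound[of n m s] powr_growth_bound[of m n s] nm s(1)
    by (metis (no_types, lifting) One_nat_def Suc_1 Suc_leD)
  define C where "C = C1 + C2"
  have C: "C > 0" "C1 \<le> C" "C2 \<le> C"
    using C1(1) C2(1) by (auto simp: C_def)
  define x y where "x = (\<lambda>z. 1 + (norm (F z))\<^sup>2)" and "y = (\<lambda>z. 1 + (norm (G z))\<^sup>2)"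
  have xy: "x z \<ge> 1" "y z \<ge> 1" for z
    by (auto simp: x_def y_def)
  define \<rho> where "\<rho> = (\<lambda>z. (norm (\<eta> z))\<^sup>2 * ((1 + x z powr s) * (1 + y z powr s)))"
  have pos: "1 + x z powr s > 0" "1 + y z powr s > 0" for z
    by (auto simp: add_pos_nonneg)
  have \<rho>0: "\<rho> z = 0" for z
  proof (rule ahlfors_schwarz_plane[of \<rho> "s\<^sup>2 / (4 * C)"])
    show "continuous_on UNIV \<rho>"
      unfolding \<rho>_def x_def y_def using hol \<eta>(1)
      by (intro continuous_intros holomorphic_on_imp_continuous_on)
         (auto simp: add_nonneg_eq_0_iff)
    show "\<rho> z \<ge> 0" for z
      using pos[of z] by (simp add: \<rho>_def)
    show "s\<^sup>2 / (4 * C) > 0"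
      using s C by simp
  next
    fix z assume "\<rho> z > 0"
    hence \<eta>z: "\<eta> z \<noteq> 0"
      by (auto simp: \<rho>_def)
    obtain g where g: "grad_laplacian (\<lambda>w. ln ((norm (\<eta> w))\<^sup>2)) z g 0"
      using grad_laplacian_ln_norm_square[OF \<eta>(1) \<eta>z] by blast
    obtain g1 L1 where L1: "grad_laplacian (\<lambda>w. ln (1 + x w powr s)) z g1 L1"
        "s\<^sup>2 * (norm (deriv F z))\<^sup>2 * x z powr (- 1 - s) \<le> L1"
      using grad_laplacian_ln_one_plus_powr[OF hol(1) s] unfolding x_def by blast
    obtain g2 L2 where L2: "grad_laplacian (\<lambda>w. ln (1 + y w powr s)) z g2 L2"
        "s\<^sup>2 * (norm (deriv G z))\<^sup>2 * y z powr (- 1 - s) \<le> L2"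
      using grad_laplacian_ln_one_plus_powr[OF hol(2) s] unfolding y_def by blast
    define u where "u = (\<lambda>w. ln ((norm (\<eta> w))\<^sup>2) + (ln (1 + x w powr s) + ln (1 + y w powr s)))"
    have "grad_laplacian u z (g + (g1 + g2)) (0 + (L1 + L2))"
      unfolding u_def by (intro grad_laplacian_add g L1 L2)
    moreover have "\<forall>\<^sub>F w in nhds z. \<rho> w = exp (u w)"
    proof -
      have "open {w. \<eta> w \<noteq> 0}"
        using \<eta>(1) by (auto intro!: open_Collect_neq holomorphic_on_imp_continuous_on)
      hence "\<forall>\<^sub>F w in nhds z. w \<in> {w. \<eta> w \<noteq> 0}"
        using \<eta>z by (intro eventually_nhds_in_open) auto
      thus ?thesis
        by eventually_elim (use pos in \<open>simp add: \<rho>_def u_def exp_add\<close>)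
    qed
    moreover have "s\<^sup>2 / (4 * C) * \<rho> z \<le> 0 + (L1 + L2)"
    proof -
      \<comment> \<open>\<open>D\<close> stands for \<open>|\<eta>|\<^sup>2\<close>, \<open>t\<close> for \<open>(|F|\<^sup>2)^(n-1)\<close> and \<open>d\<close> for \<open>|G'|\<^sup>2\<close>, or the same with \<open>F\<close> and \<open>G\<close> exchanged.\<close>
      have absorb: "D * (X powr s * Y powr s) / C \<le> d * Y powr (- 1 - s)"
        if "X powr s * Y powr (1 + 2 * s) \<le> C' * t" "C' \<le> C" "D * t \<le> d" "Y \<ge> 1" "D \<ge> 0" "t \<ge> 0"
        for X Y D C' t d :: real
      proof -
        have "X powr s * Y powr s = X powr s * Y powr (1 + 2 * s) * Y powr (- 1 - s)"
          by (simp add: powr_add[symmetric] mult.assoc)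
        also have "\<dots> \<le> C * t * Y powr (- 1 - s)"
          using that C by (intro mult_right_mono order.trans[OF that(1)]) auto
        finally have "D * (X powr s * Y powr s) \<le> D * (C * t * Y powr (- 1 - s))"
          using that by (intro mult_left_mono)
        also have "\<dots> = C * ((D * t) * Y powr (- 1 - s))"
          by simp
        also have "\<dots> \<le> C * (d * Y powr (- 1 - s))"
          using that C by (intro mult_left_mono mult_right_mono) auto
        finally show ?thesis
          using C by (simp add: field_simps)
      qed
      have nF: "(norm (\<eta> z))\<^sup>2 * ((norm (G z))\<^sup>2) ^ (m - 1) \<le> (norm (deriv F z))\<^sup>2"
      proof -
        have "1 * ((norm (\<eta> z))\<^sup>2 * ((norm (G z))\<^sup>2) ^ (m - 1)) \<le> (real m)\<^sup>2 * ((norm (\<eta> z))\<^sup>2 * ((norm (G z))\<^sup>2) ^ (m - 1))"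
          using nm by (intro mult_right_mono) auto
        thus ?thesis
          by (simp add: \<eta> norm_mult norm_power power_mult_distrib mult_ac flip: power_mult)
      qed
      have nG: "(norm (\<eta> z))\<^sup>2 * ((norm (F z))\<^sup>2) ^ (n - 1) \<le> (norm (deriv G z))\<^sup>2"
      proof -
        have "1 * ((norm (\<eta> z))\<^sup>2 * ((norm (F z))\<^sup>2) ^ (n - 1)) \<le> (real n)\<^sup>2 * ((norm (\<eta> z))\<^sup>2 * ((norm (F z))\<^sup>2) ^ (n - 1))"
          using nm by (intro mult_right_mono) auto
        thus ?thesis
          by (simp add: \<eta> norm_mult norm_power power_mult_distrib mult_ac flip: power_mult)
      qed
      define B where "B = (norm (\<eta> z))\<^sup>2 * (x z powr s * y z powr s)"
      have "1 = norm (F z ^ n + G z ^ m)"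
        by (simp add: eq)
      also have "\<dots> \<le> norm (F z) ^ n + norm (G z) ^ m"
        by (metis norm_power norm_triangle_ineq)
      finally have one: "1 \<le> norm (F z) ^ n + norm (G z) ^ m" .
      have "B / C \<le> (norm (deriv F z))\<^sup>2 * x z powr (- 1 - s) + (norm (deriv G z))\<^sup>2 * y z powr (- 1 - s)"
      proof (cases "norm (G z) ^ m \<le> norm (F z) ^ n")
        case True
        have "B / C \<le> (norm (deriv G z))\<^sup>2 * y z powr (- 1 - s)"
        proof -
          have "x z powr s * y z powr (1 + 2 * s) \<le> C1 * ((norm (F z))\<^sup>2) ^ (n - 1)"
            unfolding x_def y_def using True one by (intro C1(2)) auto
          from absorb[OF this C(2) nG] show ?thesis
            unfolding B_def using xy[of z] by simp
        qed
        thus ?thesis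
          by (simp add: add_increasing)
      next
        case False
        have "B / C \<le> (norm (deriv F z))\<^sup>2 * x z powr (- 1 - s)"
        proof -
          have "y z powr s * x z powr (1 + 2 * s) \<le> C2 * ((norm (G z))\<^sup>2) ^ (m - 1)"
            unfolding x_def y_def using False one by (intro C2(2)) auto
          from absorb[OF this C(3) nF] show ?thesis
            unfolding B_def using xy[of z] by (simp add: mult_ac)
        qed
        thus ?thesis
          by (simp add: add_increasing2)
      qed
      hence "s\<^sup>2 * (B / C) \<le> s\<^sup>2 * ((norm (deriv F z))\<^sup>2 * x z powr (- 1 - s) + (norm (deriv G z))\<^sup>2 * y z powr (- 1 - s))"
        by (rule mult_left_mono) auto
      also have "\<dots> \<le> L1 + L2"
        using L1(2) L2(2) by (simp add: algebra_simps)
      finally have *: "s\<^sup>2 * (B / C) \<le> L1 + L2" .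
      have "\<rho> z \<le> (norm (\<eta> z))\<^sup>2 * ((2 * x z powr s) * (2 * y z powr s))"
        unfolding \<rho>_def using xy[of z] s
        by (intro mult_left_mono mult_mono) (auto intro: ge_one_powr_ge_zero)
      hence "\<rho> z \<le> 4 * B"
        by (simp add: B_def)
      hence "s\<^sup>2 / (4 * C) * \<rho> z \<le> s\<^sup>2 / (4 * C) * (4 * B)"
        using C by (intro mult_left_mono) auto
      with * show ?thesis
        by simp
    qed
    ultimately show "\<exists>u g L. (\<forall>\<^sub>F w in nhds z. \<rho> w = exp (u w)) \<and> grad_laplacian u z g L \<and> s\<^sup>2 / (4 * C) * \<rho> z \<le> L"
      by blast
  qed
  have "\<eta> z = 0" for z
    using \<rho>0[of z] pos[of z] by (auto simp: \<rho>_def)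
  hence "deriv F z = 0" for z
    by (simp add: \<eta>)
  hence "(F has_field_derivative 0) (at z)" for z
    using hol(1) holomorphic_derivI[of F UNIV z] by simp
  thus ?thesis
    using has_field_derivative_zero_constant[of UNIV F] by (auto simp: constant_on_def)
qed

section \<open>Exponential solutions\<close>

lemma periodic_poly_degree_0:
  fixes p :: "complex poly"
  assumes "c \<noteq> 0" and per: "\<And>z. poly p (z + c) = poly p z"
  shows "degree p = 0"
proof -
  have val: "poly p (of_nat j * c) = poly p 0" for j
  proof (induction j)
    case (Suc j)
    thus ?case
      using per[of "of_nat j * c"] by (simp add: algebra_simps)
  qed auto
  have "inj (\<lambda>j. of_nat j * c)"
    using assms(1) by (auto simp: inj_def)
  hence "infinite (range (\<lambda>j. of_nat j * c))"
    using finite_imageD by blast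
  moreover have "range (\<lambda>j. of_nat j * c) \<subseteq> {z. poly (p - [:poly p 0:]) z = 0}"
    using val by auto
  ultimately have "p - [:poly p 0:] = 0"
    using poly_roots_finite finite_subset by blast
  hence "p = [:poly p 0:]"
    by simp
  thus ?thesis
    by (metis degree_pCons_0)
qed

lemma exp_poly_const_imp_degree_0:
  fixes q :: "complex poly"
  assumes "\<And>z. exp (poly q z) = k"
  shows "degree q = 0"
proof -
  have "poly (pderiv q) z = 0" for z
  proof -
    have "((\<lambda>z. exp (poly q z)) has_field_derivative exp (poly q z) * poly (pderiv q) z) (at z)"
      by (auto intro!: derivative_eq_intros)
    moreover have "((\<lambda>z. exp (poly q z)) has_field_derivative 0) (at z)"
      by (simp add: assms)
    ultimately show ?thesis
      using DERIV_unique by fastforce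
  qed
  thus ?thesis
    using poly_all_0_iff_0 pderiv_eq_0_iff by blast
qed

text \<open>
  Inserting \<open>f = A exp (P / n)\<close> shows that \<open>(m / n) P(z + c) - P(z)\<close> has a constant exponential and is
  therefore constant. Its leading coefficient forces \<open>m = n\<close>; then \<open>P'\<close> has period \<open>c\<close>, so \<open>P\<close> is linear.
\<close>

lemma exponential_solution_linear_exponent:
  fixes P :: "complex poly" and f :: "complex \<Rightarrow> complex"
  assumes c: "c \<noteq> 0" and nm: "n > 0" "m > 0" and nc: "\<not> f constant_on UNIV"
    and f: "\<And>z. f z = A * exp (poly P z / of_nat n)"
    and eq: "\<And>z. f z ^ n + f (z + c) ^ m = exp (poly P z)"
  shows "n = m \<and> (\<exists>\<alpha> \<beta>. \<alpha> \<noteq> 0 \<and> P = [:\<beta>, \<alpha>:] \<and> A ^ n * (1 + exp (\<alpha> * c)) = 1)"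
proof -
  have A: "A \<noteq> 0"
    using nc f by (auto simp: constant_on_def)
  have dP: "degree P \<noteq> 0"
  proof
    assume "degree P = 0"
    then obtain b where "P = [:b:]"
      by (elim degree_eq_zeroE)
    with nc f show False
      by (auto simp: constant_on_def)
  qed
  define Q where "Q = smult (of_nat m / of_nat n) (P \<circ>\<^sub>p [:c, 1:]) - P"
  have key: "A ^ m * exp (poly Q z) = 1 - A ^ n" for z
  proof -
    have "f z ^ n = A ^ n * exp (poly P z)"
      using nm by (simp add: f power_mult_distrib flip: exp_of_nat_mult)
    moreover have "f (z + c) ^ m = A ^ m * (exp (poly Q z) * exp (poly P z))"
      by (simp add: f power_mult_distrib Q_def poly_pcompose add.commute flip: exp_of_nat_mult exp_add)
    ultimately have "(A ^ m * exp (poly Q z)) * exp (poly P z) = (1 - A ^ n) * exp (poly P z)"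
      using eq[of z] by (simp add: algebra_simps)
    thus ?thesis
      by simp
  qed
  hence "exp (poly Q z) = (1 - A ^ n) / A ^ m" for z
    using A by (simp add: field_simps)
  hence dQ: "degree Q = 0"
    by (rule exp_poly_const_imp_degree_0)
  have "coeff Q (degree P) = 0"
    using dQ dP by (intro coeff_eq_0) auto
  moreover have "coeff (P \<circ>\<^sub>p [:c, 1:]) (degree P) = lead_coeff P"
    using lead_coeff_comp[of "[:c, 1:]" P] by (simp add: degree_pcompose)
  ultimately have "(of_nat m / of_nat n - 1) * lead_coeff P = 0"
    by (simp add: Q_def algebra_simps)
  hence "of_nat m / of_nat n = (1 :: complex)"
    using dP by auto
  hence mn: "n = m"
    using nm by (simp add: field_simps)
  have Q: "Q = P \<circ>\<^sub>p [:c, 1:] - P"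
    using mn nm by (simp add: Q_def)
  have "pderiv Q = 0"
    using dQ by (simp add: pderiv_eq_0_iff)
  hence "pderiv P \<circ>\<^sub>p [:c, 1:] = pderiv P"
    by (simp add: Q pderiv_diff pderiv_pcompose pderiv_pCons)
  hence "poly (pderiv P) (z + c) = poly (pderiv P) z" for z
    by (metis add.commute mult.right_neutral poly_pCons poly_0 poly_pcompose mult_zero_right add_0_right)
  hence "degree (pderiv P) = 0"
    using c by (rule periodic_poly_degree_0[rotated])
  hence dP1: "degree P = 1"
    using dP by (simp add: degree_pderiv)
  obtain \<beta> q where q: "P = pCons \<beta> q"
    by (cases P)
  moreover have "degree q = 0"
    using dP1 q by (auto split: if_splits)
  then obtain \<alpha> where "q = [:\<alpha>:]"
    by (elim degree_eq_zeroE)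
  ultimately have P: "P = [:\<beta>, \<alpha>:]"
    by simp
  hence "\<alpha> \<noteq> 0"
    using dP by auto
  moreover have "A ^ n * (1 + exp (\<alpha> * c)) = 1"
    using key[of 0] mn by (simp add: Q P poly_pcompose algebra_simps)
  ultimately show ?thesis
    using mn P by blast
qed

section \<open>Poles of a solution\<close>

lemma is_pole_imp_not_isCont_summand:
  fixes f g E :: "complex \<Rightarrow> complex"
  assumes "is_pole f z" and "n > 0" and "isCont E z"
    and ev: "\<forall>\<^sub>F w in at z. f w ^ n + g w ^ m = E w"
  shows "\<not> isCont g z"
proof
  assume "isCont g z"
  hence "((\<lambda>w. E w - g w ^ m) \<longlongrightarrow> E z - g z ^ m) (at z)"
    using assms(3) by (auto intro!: tendsto_intros simp: isCont_def)
  moreover have "\<forall>\<^sub>F w in at z. E w - g w ^ m = f w ^ n"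
    using ev by eventually_elim (auto simp: algebra_simps)
  ultimately have "((\<lambda>w. f w ^ n) \<longlongrightarrow> E z - g z ^ m) (at z)"
    by (rule Lim_transform_eventually)
  moreover have "filterlim (\<lambda>w. f w ^ n) at_infinity (at z)"
    using assms(1,2) unfolding is_pole_def by (intro Limits.filterlim_power_at_infinity)
  ultimately show False
    using not_tendsto_and_filterlim_at_infinity[of "at z"] by auto
qed

text \<open>
  If the pole orders of the two powers differed, the larger one would survive in the sum, but the
  sum is holomorphic.
\<close>

lemma zorder_eq_at_common_pole:
  fixes f g E :: "complex \<Rightarrow> complex"
  assumes mero: "f meromorphic_on {z}" "g meromorphic_on {z}" and pole: "is_pole f z" "is_pole g z"
    and E: "E analytic_on {z}" "E z \<noteq> 0" and nm: "n > 0" "m > 0"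
    and ev: "\<forall>\<^sub>F w in at z. f w ^ n + g w ^ m = E w"
  shows "int n * zorder f z = int m * zorder g z"
proof -
  have fg: "\<forall>\<^sub>F w in at z. f w \<noteq> 0" "\<forall>\<^sub>F w in at z. g w \<noteq> 0"
    using pole by (auto intro: non_zero_neighbour_pole)
  have freq: "\<exists>\<^sub>F w in at z. f w \<noteq> 0" "\<exists>\<^sub>F w in at z. g w \<noteq> 0"
      "\<exists>\<^sub>F w in at z. f w ^ n \<noteq> 0" "\<exists>\<^sub>F w in at z. g w ^ m \<noteq> 0"
    using eventually_frequently[OF _ fg(1)] eventually_frequently[OF _ fg(2)] nm
    by (auto simp: at_neq_bot power_eq_0_iff elim!: frequently_elim1)
  have zf: "zorder (\<lambda>w. f w ^ n) z = int n * zorder f z" and zg: "zorder (\<lambda>w. g w ^ m) z = int m * zorder g z"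
    using mero freq by (auto intro!: zorder_power)
  have neg: "int n * zorder f z < 0" "int m * zorder g z < 0"
    using isolated_pole_imp_neg_zorder pole mero nm
    by (auto intro!: mult_pos_neg meromorphic_on_isolated_singularity)
  have "zorder (\<lambda>w. f w ^ n + g w ^ m) z = zorder E z"
    using ev by (intro zorder_cong) auto
  also have "\<dots> = 0"
    using E by (rule zorder_eq_0I)
  finally have "zorder (\<lambda>w. f w ^ n + g w ^ m) z = 0" .
  moreover have "(\<lambda>w. f w ^ n) meromorphic_on {z}" "(\<lambda>w. g w ^ m) meromorphic_on {z}"
    using mero by (auto intro: meromorphic_on_power)
  ultimately show ?thesis
    using zorder_add1[of "\<lambda>w. f w ^ n" z "\<lambda>w. g w ^ m"] zorder_add2[of "\<lambda>w. f w ^ n" z "\<lambda>w. g w ^ m"]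
      freq(3,4) neg unfolding zf zg by linarith
qed

text \<open>
  The equation holds off the poles of \<open>f\<close> and of its shift, and these are isolated; so near every
  point, poles included, it holds in a punctured neighbourhood.
\<close>

lemma shift_equation_eventually:
  assumes "f nicely_meromorphic_on UNIV" and "solves_fermat_shift_eq n m c P f"
  shows "\<forall>\<^sub>F w in at z. f w ^ n + f (w + c) ^ m = exp (poly P w) \<and> \<not> is_pole f w \<and> \<not> is_pole f (w + c)"
proof -
  have "\<forall>\<^sub>F w in cosparse UNIV. \<not> is_pole f w"
    using assms(1) by (intro meromorphic_on_imp_not_pole_cosparse) (simp add: nicely_meromorphic_on_def)
  hence np: "\<forall>\<^sub>F w in at x. \<not> is_pole f w" for x
    by (rule eventually_cosparse_imp_eventually_at) auto
  have "filtermap (\<lambda>w. w + c) (at z) = at (z + c)"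
    using filtermap_at_shift[of "-c" z] by simp
  with np[of "z + c"] have "\<forall>\<^sub>F w in filtermap (\<lambda>w. w + c) (at z). \<not> is_pole f w"
    by simp
  hence "\<forall>\<^sub>F w in at z. \<not> is_pole f (w + c)"
    by (simp only: eventually_filtermap)
  with np[of z] show ?thesis
    by eventually_elim (use assms(2) in \<open>auto simp: solves_fermat_shift_eq_def\<close>)
qed

lemma is_pole_shift: "is_pole (\<lambda>w. f (w + c)) z \<longleftrightarrow> is_pole f (z + c)" for c :: complex
  using is_pole_shift_iff[of f c z] by (simp add: o_def add.commute)

lemma meromorphic_shift:
  assumes "f nicely_meromorphic_on UNIV"
  shows "(\<lambda>w. f (w + c)) meromorphic_on A"
  by (rule meromorphic_on_compose[of f UNIV])
     (use assms in \<open>auto simp: nicely_meromorphic_on_def intro!: analytic_intros\<close>)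

lemma shift_poles:
  assumes f: "f nicely_meromorphic_on UNIV" and sol: "solves_fermat_shift_eq n m c P f"
    and nm: "n > 0" "m > 0"
  shows "is_pole f z \<longleftrightarrow> is_pole f (z + c)"
    and "is_pole f z \<Longrightarrow> int n * zorder f z = int m * zorder f (z + c)"
proof -
  have cont: "isCont f w" if "\<not> is_pole f w" for w
    using nicely_meromorphic_on_imp_analytic_at[OF f _ that] by (simp add: analytic_at_imp_isCont)
  have cont_shift: "isCont (\<lambda>w. f (w + c)) z" if "\<not> is_pole f (z + c)"
    using cont[OF that] by (intro isCont_o2[of z "\<lambda>w. w + c" f]) auto
  have ev: "\<forall>\<^sub>F w in at z. f w ^ n + f (w + c) ^ m = exp (poly P w)"
    by (rule eventually_mono[OF shift_equation_eventually[OF f sol]]) auto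
  hence ev': "\<forall>\<^sub>F w in at z. f (w + c) ^ m + f w ^ n = exp (poly P w)"
    by (simp add: add.commute)
  have E: "isCont (\<lambda>w. exp (poly P w)) z"
    by (intro continuous_intros)
  show iff: "is_pole f z \<longleftrightarrow> is_pole f (z + c)"
  proof
    assume "is_pole f z"
    from is_pole_imp_not_isCont_summand[OF this nm(1) E ev] cont_shift
    show "is_pole f (z + c)" by blast
  next
    assume "is_pole f (z + c)"
    hence "is_pole (\<lambda>w. f (w + c)) z"
      by (simp add: is_pole_shift)
    from is_pole_imp_not_isCont_summand[OF this nm(2) E ev'] cont
    show "is_pole f z" by blast
  qed
  assume pole: "is_pole f z"
  have "int n * zorder f z = int m * zorder (\<lambda>w. f (w + c)) z"
  proof (rule zorder_eq_at_common_pole[OF _ meromorphic_shift[OF f] pole _ _ _ nm ev])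
    show "f meromorphic_on {z}"
      using f meromorphic_on_subset by (auto simp: nicely_meromorphic_on_def)
    show "is_pole (\<lambda>w. f (w + c)) z"
      using pole iff by (simp add: is_pole_shift)
    have "(\<lambda>w. exp (poly P w)) analytic_on UNIV"
      by (auto simp: analytic_on_open intro!: holomorphic_intros)
    thus "(\<lambda>w. exp (poly P w)) analytic_on {z}"
      by (rule analytic_on_subset) auto
  qed simp
  also have "zorder (\<lambda>w. f (w + c)) z = zorder f (z + c)"
    using zorder_shift[of "\<lambda>w. f (w + c)" z] zorder_shift[of f "z + c"] by (simp add: add.assoc)
  finally show "int n * zorder f z = int m * zorder f (z + c)" .
qed

text \<open>
  Shifting by \<open>c\<close> multiplies the order of a pole by \<open>n / m\<close>, and shifting by \<open>- c\<close> by \<open>m / n\<close>. One of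
  these factors is less than 1, so a pole of least order cannot exist.
\<close>

lemma no_poles_if_exponents_differ:
  assumes f: "f nicely_meromorphic_on UNIV" and sol: "solves_fermat_shift_eq n m c P f"
    and nm: "n > 0" "m > 0" "n \<noteq> m"
  shows "\<not> is_pole f z"
proof
  assume "is_pole f z"
  then obtain a where a: "is_pole f a" "\<And>w. is_pole f w \<Longrightarrow> nat (- zorder f a) \<le> nat (- zorder f w)"
    using ex_has_least_nat[of "is_pole f" z "\<lambda>w. nat (- zorder f w)"] by blast
  have neg: "zorder f w < 0" if "is_pole f w" for w
    using that f
    by (intro isolated_pole_imp_neg_zorder meromorphic_on_isolated_singularity)
       (auto simp: nicely_meromorphic_on_def intro: meromorphic_on_subset)
  have min: "zorder f w \<le> zorder f a" if "is_pole f w" for w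
    using a(2)[OF that] neg[OF that] neg[OF a(1)] by simp
  have pl: "is_pole f (a + c)" "is_pole f (a - c)"
    using shift_poles(1)[OF f sol nm(1,2), of a] shift_poles(1)[OF f sol nm(1,2), of "a - c"] a(1) by auto
  have "int n * zorder f a = int m * zorder f (a + c)"
    using shift_poles(2)[OF f sol nm(1,2) a(1)] .
  also have "\<dots> \<le> int m * zorder f a"
    using min[OF pl(1)] by (intro mult_left_mono) auto
  finally have "m \<le> n"
    using neg[OF a(1)] by (simp add: mult_le_cancel_right)
  have "int m * zorder f a = int n * zorder f (a - c)"
    using shift_poles(2)[OF f sol nm(1,2) pl(2)] by simp
  also have "\<dots> \<le> int n * zorder f a"
    using min[OF pl(2)] by (intro mult_left_mono) auto
  finally have "n \<le> m"
    using neg[OF a(1)] by (simp add: mult_le_cancel_right)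
  with \<open>m \<le> n\<close> nm show False
    by simp
qed

section \<open>Reduction to exponential solutions\<close>

lemma meromorphic_root_of_entire:
  assumes "Y0 meromorphic_on UNIV" and E: "E holomorphic_on UNIV" and n: "n > 0"
    and ev: "\<And>z. \<forall>\<^sub>F w in at z. Y0 w ^ n = E w"
  obtains Y where "Y holomorphic_on UNIV" "\<And>z::complex. Y z ^ n = E z"
proof
  define Y where "Y = remove_sings Y0"
  have Y: "Y nicely_meromorphic_on UNIV"
    unfolding Y_def using assms(1) by (rule remove_sings_nicely_meromorphic)
  have evY: "\<forall>\<^sub>F w in at z. E w = Y w ^ n" for z
  proof -
    have "isolated_singularity_at Y0 z"
      using assms(1) by (auto intro: meromorphic_on_isolated_singularity meromorphic_on_subset)
    from eventually_remove_sings_eq_at[OF this] ev[of z] show ?thesis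
      by eventually_elim (simp add: Y_def)
  qed
  have Elim: "(E \<longlongrightarrow> E z) (at z)" for z
    using E holomorphic_on_imp_continuous_on[of E UNIV] by (auto simp: continuous_on_def)
  have "\<not> is_pole Y z" for z
  proof
    assume "is_pole Y z"
    hence "filterlim (\<lambda>w. Y w ^ n) at_infinity (at z)"
      using n unfolding is_pole_def by (intro Limits.filterlim_power_at_infinity)
    moreover have "((\<lambda>w. Y w ^ n) \<longlongrightarrow> E z) (at z)"
      using Elim evY by (rule Lim_transform_eventually)
    ultimately show False
      using not_tendsto_and_filterlim_at_infinity[of "at z"] by auto
  qed
  with Y have "Y analytic_on UNIV"
    by (intro nicely_meromorphic_without_singularities) auto
  thus hol: "Y holomorphic_on UNIV"
    by (rule analytic_imp_holomorphic)
  show "Y z ^ n = E z" for z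
  proof -
    have "((\<lambda>w. Y w ^ n) \<longlongrightarrow> Y z ^ n) (at z)"
      using holomorphic_on_imp_continuous_on[OF hol] by (auto simp: continuous_on_def intro!: tendsto_intros)
    moreover have "((\<lambda>w. Y w ^ n) \<longlongrightarrow> E z) (at z)"
      using Elim evY by (rule Lim_transform_eventually)
    ultimately show ?thesis
      using tendsto_unique[of "at z"] by auto
  qed
qed

text \<open>
  Weierstrass factorization writes \<open>f exp (- P / n)\<close> as \<open>X / f2\<close> with entire \<open>X\<close> and \<open>f2\<close> without
  common zeros. The shifted function times \<open>f2 exp (- P / n)\<close> has the entire \<open>n\<close>-th power \<open>f2\<^sup>n - X\<^sup>n\<close>, hence
  extends to an entire function, and the three functions lie on the Fermat curve.
\<close>

lemma equal_exponents_imp_exponential: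
  assumes f: "f nicely_meromorphic_on UNIV" and sol: "solves_fermat_shift_eq n n c P f"
    and nc: "\<not> f constant_on UNIV" and n: "n \<ge> 4"
  obtains A where "\<And>z. f z = A * exp (poly P z / of_nat n)"
proof -
  obtain h f1 f2 where W:
    "h holomorphic_on UNIV" "f1 holomorphic_on UNIV" "f2 holomorphic_on UNIV"
    "\<And>z. f1 z = 0 \<longleftrightarrow> \<not> is_pole f z \<and> f z = 0"
    "\<And>z. f2 z = 0 \<longleftrightarrow> is_pole f z" "\<And>z. h z \<noteq> 0" "\<And>z. f z = h z * f1 z / f2 z"
    using weierstrass_factorization_meromorphic_UNIV[OF f] by metis
  define e where "e = (\<lambda>z. exp (- poly P z / of_nat n))"
  have e: "e holomorphic_on UNIV"
    unfolding e_def using n by (intro holomorphic_intros) auto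
  have e_pow: "e z ^ n * exp (poly P z) = 1" for z
    using n by (simp add: e_def flip: exp_of_nat_mult exp_add)
  define X where "X = (\<lambda>z. h z * f1 z * e z)"
  have X: "X holomorphic_on UNIV"
    unfolding X_def by (intro holomorphic_intros W e)
  have XZ: "X z \<noteq> 0 \<or> f2 z \<noteq> 0" for z
    using W(4,5,6)[of z] by (auto simp: X_def e_def)
  obtain Y where Y: "Y holomorphic_on UNIV" "\<And>z. Y z ^ n = f2 z ^ n - X z ^ n"
  proof (rule meromorphic_root_of_entire[of "\<lambda>z. f2 z * f (z + c) * e z" "\<lambda>z. f2 z ^ n - X z ^ n" n])
    show "(\<lambda>z. f2 z * f (z + c) * e z) meromorphic_on UNIV"
      using W(3) e by (intro meromorphic_intros meromorphic_shift[OF f] analytic_on_imp_meromorphic_on)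
         (auto simp: analytic_on_open)
    show "(\<lambda>z. f2 z ^ n - X z ^ n) holomorphic_on UNIV"
      by (intro holomorphic_intros W X)
    show "\<forall>\<^sub>F w in at z. (f2 w * f (w + c) * e w) ^ n = f2 w ^ n - X w ^ n" for z
      using shift_equation_eventually[OF f sol, of z]
    proof eventually_elim
      case (elim w)
      hence "f2 w \<noteq> 0"
        by (simp add: W(5))
      hence "X w = f2 w * f w * e w"
        by (simp add: X_def W(7))
      hence "(f2 w * f (w + c) * e w) ^ n + X w ^ n = f2 w ^ n * (e w ^ n * (f w ^ n + f (w + c) ^ n))"
        by (simp add: power_mult_distrib algebra_simps)
      also have "\<dots> = f2 w ^ n"
        using elim e_pow[of w] by simp
      finally show ?case
        by (simp add: algebra_simps)
    qed
  qed (use n in auto)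
  have "\<exists>z0. f2 z0 \<noteq> 0"
  proof (rule ccontr)
    assume "\<nexists>z0. f2 z0 \<noteq> 0"
    hence "f z = 0" for z
      using W(7)[of z] by simp
    with nc show False
      by (auto simp: constant_on_def)
  qed
  then obtain z0 where z0: "f2 z0 \<noteq> 0"
    by blast
  define A where "A = X z0 / f2 z0"
  have XA: "X z = A * f2 z" for z
    unfolding A_def using XZ z0 by (intro fermat_curve_proportional[OF X Y(1) W(3) n]) (auto simp: Y(2))
  hence f2: "f2 z \<noteq> 0" for z
    using XZ[of z] by auto
  show thesis
  proof (rule that[of A])
    show "f z = A * exp (poly P z / of_nat n)" for z
    proof -
      have "f z * e z = A"
        using XA[of z] f2[of z] by (simp add: X_def W(7) field_simps)
      moreover have "e z * exp (poly P z / of_nat n) = 1"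
        by (simp add: e_def flip: exp_add)
      ultimately show ?thesis
        by (metis mult.assoc mult.right_neutral)
    qed
  qed
qed

text \<open>
  Since there are no poles, dividing the equation by \<open>exp P\<close> gives an entire point of the affine curve
  \<open>x\<^sup>n + y\<^sup>m = 1\<close>.
\<close>

lemma different_exponents_imp_exponential:
  assumes f: "f nicely_meromorphic_on UNIV" and sol: "solves_fermat_shift_eq n m c P f"
    and nm: "n \<ge> 2" "m \<ge> 2" "n \<noteq> m"
  obtains A where "\<And>z. f z = A * exp (poly P z / of_nat n)"
proof -
  have np: "\<not> is_pole f z" for z
    using no_poles_if_exponents_differ[OF f sol] nm by auto
  hence hol: "f holomorphic_on UNIV"
    using f by (intro analytic_imp_holomorphic nicely_meromorphic_without_singularities) auto
  define F where "F = (\<lambda>z. f z * exp (- poly P z / of_nat n))"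
  define G where "G = (\<lambda>z. f (z + c) * exp (- poly P z / of_nat m))"
  have "F constant_on UNIV"
  proof (rule entire_power_sum_one_constant)
    show "F holomorphic_on UNIV"
      unfolding F_def using nm by (intro holomorphic_intros hol) auto
    have "(f \<circ> (\<lambda>z. z + c)) holomorphic_on UNIV"
      by (intro holomorphic_on_compose_gen[of _ _ _ UNIV] holomorphic_intros hol) auto
    thus "G holomorphic_on UNIV"
      unfolding G_def using nm by (intro holomorphic_intros) (auto simp: o_def)
    show "F z ^ n + G z ^ m = 1" for z
    proof -
      have "F z ^ n = f z ^ n * exp (- poly P z)" "G z ^ m = f (z + c) ^ m * exp (- poly P z)"
        using nm by (simp_all add: F_def G_def power_mult_distrib flip: exp_of_nat_mult)
      hence "F z ^ n + G z ^ m = exp (poly P z) * exp (- poly P z)"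
        using sol np by (simp add: solves_fermat_shift_eq_def flip: distrib_right)
      thus ?thesis
        by (simp flip: exp_add)
    qed
  qed (use nm in auto)
  then obtain A where "\<And>z. F z = A"
    by (auto simp: constant_on_def)
  hence "f z = A * exp (poly P z / of_nat n)" for z
    by (auto simp: F_def exp_minus field_simps)
  thus thesis
    by (rule that)
qed

section \<open>The characterization\<close>

theorem corollary1:
  fixes c :: complex and P :: "complex poly" and f :: "complex \<Rightarrow> complex" and n m :: nat
  assumes "c \<noteq> 0"
    and "f nicely_meromorphic_on UNIV"
    and "\<not> f constant_on UNIV"
    and "n \<ge> 2" and "m \<ge> 2" and "m + n \<ge> 5" and "(n, m) \<noteq> (3, 3)"
  shows "solves_fermat_shift_eq n m c P f \<longleftrightarrow>
           n = m \<and>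
           (\<exists>A \<alpha> \<beta>. \<alpha> \<noteq> 0 \<and> P = [:\<beta>, \<alpha>:] \<and>
              (\<forall>z. f z = A * exp (poly P z / of_nat n)) \<and>
              A ^ n * (1 + exp (\<alpha> * c)) = 1)"
proof
  assume sol: "solves_fermat_shift_eq n m c P f"
  obtain A where A: "\<And>z. f z = A * exp (poly P z / of_nat n)"
  proof (cases "n = m")
    case True
    with assms have "n \<ge> 4"
      by auto
    with sol True assms show thesis
      by (auto elim!: equal_exponents_imp_exponential intro: that)
  next
    case False
    with sol assms show thesis
      by (auto elim!: different_exponents_imp_exponential intro: that)
  qed
  have "f = (\<lambda>z. A * exp (poly P z / of_nat n))"
    using A by auto
  hence "f holomorphic_on UNIV"
    using assms by (auto intro!: holomorphic_intros)
  hence "\<not> is_pole f z" for z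
    by (intro not_is_pole_holomorphic[of UNIV]) auto
  hence "f z ^ n + f (z + c) ^ m = exp (poly P z)" for z
    using sol by (simp add: solves_fermat_shift_eq_def)
  from exponential_solution_linear_exponent[OF assms(1) _ _ assms(3) A this] assms A
  show "n = m \<and> (\<exists>A \<alpha> \<beta>. \<alpha> \<noteq> 0 \<and> P = [:\<beta>, \<alpha>:] \<and>
      (\<forall>z. f z = A * exp (poly P z / of_nat n)) \<and> A ^ n * (1 + exp (\<alpha> * c)) = 1)"
    by auto
next
  assume "n = m \<and> (\<exists>A \<alpha> \<beta>. \<alpha> \<noteq> 0 \<and> P = [:\<beta>, \<alpha>:] \<and>
      (\<forall>z. f z = A * exp (poly P z / of_nat n)) \<and> A ^ n * (1 + exp (\<alpha> * c)) = 1)"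
  then obtain A \<alpha> \<beta> where *: "n = m" "P = [:\<beta>, \<alpha>:]" "\<And>z. f z = A * exp (poly P z / of_nat n)"
      "A ^ n * (1 + exp (\<alpha> * c)) = 1"
    by blast
  have pow: "f z ^ n = A ^ n * exp (poly P z)" for z
    using assms(4) by (simp add: *(3) power_mult_distrib flip: exp_of_nat_mult)
  have "f z ^ n + f (z + c) ^ m = exp (poly P z)" for z
  proof -
    have "f z ^ n + f (z + c) ^ m = A ^ n * exp (poly P z) + A ^ n * exp (poly P (z + c))"
      using pow *(1) by simp
    also have "poly P (z + c) = poly P z + \<alpha> * c"
      by (simp add: *(2) algebra_simps)
    also have "A ^ n * exp (poly P z) + A ^ n * exp (poly P z + \<alpha> * c)
        = exp (poly P z) * (A ^ n * (1 + exp (\<alpha> * c)))"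
      by (simp add: exp_add algebra_simps)
    finally show ?thesis
      by (simp add: *(4))
  qed
  thus "solves_fermat_shift_eq n m c P f"
    by (simp add: solves_fermat_shift_eq_def)
qed

end
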